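(* The Secluded Path problem can be solved in polynomial time on unweighted undirected graphs of bounded (constant) maximum degree.
   Context: For $u\in V(G)$, $N[u]$ is $u$ together with its neighbors; for a subgraph $G'$, $N[G']=\bigcup_{u\in V(G')}N[u]$ and $\mathrm{Cost}(G')=|N[G']|$. Secluded Path problem: given $G$ and nodes $s,t$, find an $s$-$t$ path $P$ minimizing $\mathrm{Cost}(P)$. *)

theory Defs
  imports Main
begin

text \<open>A finite simple undirected graph has vertex set {0..<n} and a symmetric,
  irreflexive adjacency relation E (only its values on {0..<n} matter).\<close>

definition simple_graph :: "nat \<Rightarrow> (nat \<Rightarrow> nat \<Rightarrow> bool) \<Rightarrow> bool" where
  "simple_graph n E \<longleftrightarrow> (\<forall>u<n. \<forall>v<n. E u v \<longrightarrow> E v u) \<and> (\<forall>u<n. \<not> E u u)"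

definition max_degree_le :: "nat \<Rightarrow> (nat \<Rightarrow> nat \<Rightarrow> bool) \<Rightarrow> nat \<Rightarrow> bool" where
  "max_degree_le n E \<Delta> \<longleftrightarrow> (\<forall>u<n. card {v. v < n \<and> E u v} \<le> \<Delta>)"

definition closed_nbh :: "nat \<Rightarrow> (nat \<Rightarrow> nat \<Rightarrow> bool) \<Rightarrow> nat \<Rightarrow> nat set" where
  "closed_nbh n E u = insert u {v. v < n \<and> E u v}"

definition closed_nbh_set :: "nat \<Rightarrow> (nat \<Rightarrow> nat \<Rightarrow> bool) \<Rightarrow> nat set \<Rightarrow> nat set" where
  "closed_nbh_set n E S = (\<Union>u\<in>S. closed_nbh n E u)"

definition path_cost :: "nat \<Rightarrow> (nat \<Rightarrow> nat \<Rightarrow> bool) \<Rightarrow> nat list \<Rightarrow> nat" where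
  "path_cost n E P = card (closed_nbh_set n E (set P))"

definition is_path :: "nat \<Rightarrow> (nat \<Rightarrow> nat \<Rightarrow> bool) \<Rightarrow> nat \<Rightarrow> nat \<Rightarrow> nat list \<Rightarrow> bool" where
  "is_path n E s t P \<longleftrightarrow> P \<noteq> [] \<and> hd P = s \<and> last P = t \<and> distinct P \<and>
     (\<forall>v\<in>set P. v < n) \<and> (\<forall>i. Suc i < length P \<longrightarrow> E (P ! i) (P ! Suc i))"

definition optimal_secluded_path ::
  "nat \<Rightarrow> (nat \<Rightarrow> nat \<Rightarrow> bool) \<Rightarrow> nat \<Rightarrow> nat \<Rightarrow> nat list \<Rightarrow> bool" where
  "optimal_secluded_path n E s t P \<longleftrightarrow> is_path n E s t P \<and>
     (\<forall>Q. is_path n E s t Q \<longrightarrow> path_cost n E P \<le> path_cost n E Q)"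

text \<open>A single unbounded memory of natural numbers (registers = memory cells),
  with direct and indirect addressing. No multiplication, so unit-cost time is
  polynomially equivalent to Turing machine time.\<close>

datatype instr =
    Const nat nat
  | Add nat nat nat
  | Sub nat nat nat
  | Load nat nat
  | Store nat nat
  | Jz nat nat
  | Halt

type_synonym config = "nat \<times> (nat \<Rightarrow> nat)"

definition halted :: "instr list \<Rightarrow> config \<Rightarrow> bool" where
  "halted p c \<longleftrightarrow> fst c \<ge> length p \<or> p ! fst c = Halt"

fun exec :: "instr \<Rightarrow> config \<Rightarrow> config" where
  "exec (Const r k) (pc, m) = (Suc pc, m(r := k))"
| "exec (Add r a b) (pc, m) = (Suc pc, m(r := m a + m b))"
| "exec (Sub r a b) (pc, m) = (Suc pc, m(r := m a - m b))"
| "exec (Load r a) (pc, m) = (Suc pc, m(r := m (m a)))"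
| "exec (Store a b) (pc, m) = (Suc pc, m(m a := m b))"
| "exec (Jz r l) (pc, m) = ((if m r = 0 then l else Suc pc), m)"
| "exec Halt c = c"

definition step :: "instr list \<Rightarrow> config \<Rightarrow> config" where
  "step p c = (if halted p c then c else exec (p ! fst c) c)"

definition run :: "instr list \<Rightarrow> nat \<Rightarrow> (nat \<Rightarrow> nat) \<Rightarrow> config" where
  "run p T m0 = (step p ^^ T) (0, m0)"

text \<open>Input encoding: m[0] = n, m[1] = s, m[2] = t, and
  m[3 + i*n + j] = 1 iff {i,j} is an edge (i,j < n); all other cells 0.\<close>
definition encode :: "nat \<Rightarrow> (nat \<Rightarrow> nat \<Rightarrow> bool) \<Rightarrow> nat \<Rightarrow> nat \<Rightarrow> nat \<Rightarrow> nat" where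
  "encode n E s t = (\<lambda>a. if a = 0 then n else if a = 1 then s else if a = 2 then t
      else if a < 3 + n * n \<and> E ((a - 3) div n) ((a - 3) mod n) then 1 else 0)"

definition decode :: "(nat \<Rightarrow> nat) \<Rightarrow> nat list" where
  "decode m = map (\<lambda>i. m (Suc i)) [0..<m 0]"

definition solves_secluded_path_poly :: "nat \<Rightarrow> instr list \<Rightarrow> bool" where
  "solves_secluded_path_poly \<Delta> p \<longleftrightarrow> (\<exists>c k::nat. \<forall>n E s t.
     simple_graph n E \<longrightarrow> max_degree_le n E \<Delta> \<longrightarrow> s < n \<longrightarrow> t < n \<longrightarrow>
     (let cf = run p (c * (n + 1) ^ k) (encode n E s t) in
        halted p cf \<and>
        ((\<exists>P. is_path n E s t P) \<longrightarrow> optimal_secluded_path n E s t (decode (snd cf))) \<and>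
        ((\<nexists>P. is_path n E s t P) \<longrightarrow> decode (snd cf) = [])))"

end

theory Submission
  imports Defs
begin

text \<open>
  Let \<open>P\<close> be an optimal path with as few vertices as possible. Then \<open>P\<close> is induced, and every
  vertex \<open>x\<close> sees only vertices of \<open>P\<close> that lie at most \<open>K = \<Delta> + 3\<close> steps apart: otherwise the
  detour through \<open>x\<close> adds at most \<open>\<Delta> + 1\<close> vertices to the closed neighbourhood and drops at least
  as many, and it is shorter. Hence the cost of \<open>P\<close> is the sum, over its vertices \<open>v\<close>, of the
  number of vertices in \<open>N[v]\<close> outside the closed neighbourhood of the \<open>K\<close> vertices visited
  just before \<open>v\<close>. For an arbitrary walk this sum is an upper bound on the cost, so a walk from \<open>t\<close>
  to \<open>s\<close> that minimises first this sum and then the length is an optimal path. Such a walk is a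
  shortest path in a graph whose nodes are windows of \<open>K\<close> vertices, of which there are \<open>n ^ K\<close>.

  On the machine a node is a number \<open>q = (n * cost + length) * n ^ K + window\<close>, where the window
  is written in base \<open>n\<close> with the newest vertex as the last digit. Edges increase \<open>q\<close>, so one pass
  over a table indexed by \<open>q\<close> decides reachability, the least reachable \<open>q\<close> with last digit \<open>s\<close>
  is the lexicographic optimum, and following predecessors lists the path from \<open>s\<close> to \<open>t\<close>.
\<close>

section \<open>Arithmetic expressions compiled to the machine\<close>

text \<open>The window sum only bounds the cost of a walk from above. Minimising it is sound by a
  squeeze: at a suitable optimal path the sum equals the cost, and every walk contains a path whose
  cost is at most its sum. A window could not record distinctness of a walk; minimal length restores
  it. Walks start at \<open>t\<close> because following predecessors from the goal then lists the
  vertices from \<open>s\<close> to \<open>t\<close>.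

  The other obstacle is the machine. It has no multiplication, and input and output occupy the very
  cells that have to serve as registers: the matrix starts at cell 3 and the answer at cell 0. So a
  fixed initial block is freed by packing its matrix bits into one number, all computing is done in
  a language of expressions whose only loop is a bounded sum, and the answer is moved to the front
  at the very end. Time is bounded compositionally: each expression has an exponent, independent of
  the graph, to which a common bound \<open>M\<close> on the memory is raised.\<close>

definition code_at :: "instr list \<Rightarrow> nat \<Rightarrow> instr list \<Rightarrow> bool" where
  "code_at p pc c \<longleftrightarrow> (\<forall>i<length c. pc + i < length p \<and> p ! (pc + i) = c ! i)"

definition steps :: "instr list \<Rightarrow> nat \<Rightarrow> config \<Rightarrow> config \<Rightarrow> bool" where
  "steps p T c c' \<longleftrightarrow> (step p ^^ T) c = c'"

lemma code_at_Nil [simp]: "code_at p pc []"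
  by (simp add: code_at_def)

lemma code_at_append [simp]:
  "code_at p pc (a @ b) \<longleftrightarrow> code_at p pc a \<and> code_at p (pc + length a) b"
proof
  assume L: "code_at p pc (a @ b)"
  have "code_at p pc a"
    using L unfolding code_at_def by (metis length_append nth_append trans_less_add1)
  moreover have "code_at p (pc + length a) b"
    unfolding code_at_def
  proof (intro allI impI)
    fix i assume "i < length b"
    with L[unfolded code_at_def, rule_format, of "length a + i"]
    show "pc + length a + i < length p \<and> p ! (pc + length a + i) = b ! i"
      by (simp add: nth_append add.assoc)
  qed
  ultimately show "code_at p pc a \<and> code_at p (pc + length a) b" ..
next
  assume R: "code_at p pc a \<and> code_at p (pc + length a) b"
  show "code_at p pc (a @ b)"
    unfolding code_at_def
  proof (intro allI impI)
    fix i assume i: "i < length (a @ b)"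
    show "pc + i < length p \<and> p ! (pc + i) = (a @ b) ! i"
    proof (cases "i < length a")
      case True
      then show ?thesis using R by (simp add: code_at_def nth_append)
    next
      case False
      then obtain j where j: "i = length a + j" by (metis le_add_diff_inverse not_less)
      with R i show ?thesis
        by (simp add: code_at_def nth_append add.assoc)
    qed
  qed
qed

lemma code_at_Cons [simp]:
  "code_at p pc (i # c) \<longleftrightarrow> pc < length p \<and> p ! pc = i \<and> code_at p (Suc pc) c"
proof -
  have "code_at p pc ([i] @ c) \<longleftrightarrow> code_at p pc [i] \<and> code_at p (pc + length [i]) c"
    by (rule code_at_append)
  then show ?thesis by (simp add: code_at_def)
qed

lemma code_at_self: "code_at p 0 p"
  by (simp add: code_at_def)

lemma steps_0 [simp]: "steps p 0 c c' \<longleftrightarrow> c = c'"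
  by (simp add: steps_def)

lemma steps_Suc: "steps p (Suc T) c c' \<longleftrightarrow> steps p T (step p c) c'"
  by (simp add: steps_def funpow_swap1)

lemma steps_1 [simp]: "steps p (Suc 0) c c' \<longleftrightarrow> step p c = c'"
  by (simp add: steps_Suc)

lemma steps_trans: "steps p T c c' \<Longrightarrow> steps p U c' c'' \<Longrightarrow> steps p (T + U) c c''"
  unfolding steps_def by (simp add: add.commute[of T] funpow_add)

lemma step_exec [simp]:
  "pc < length p \<Longrightarrow> p ! pc \<noteq> Halt \<Longrightarrow> step p (pc, m) = exec (p ! pc) (pc, m)"
  by (simp add: step_def halted_def)

lemma halted_funpow: "halted p c \<Longrightarrow> (step p ^^ T) c = c"
  by (induction T) (simp_all add: step_def)

fun straight :: "instr \<Rightarrow> bool" where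
  "straight (Jz r l) = False"
| "straight Halt = False"
| "straight _ = True"

fun exec_list :: "instr list \<Rightarrow> (nat \<Rightarrow> nat) \<Rightarrow> (nat \<Rightarrow> nat)" where
  "exec_list [] m = m"
| "exec_list (i # c) m = exec_list c (snd (exec i (0, m)))"

lemma steps_straight:
  assumes "code_at p pc c" "list_all straight c" "T = length c"
  shows "steps p T (pc, m) (pc + T, exec_list c m)"
  using assms
proof (induction c arbitrary: pc m T)
  case (Cons i c)
  have "exec i (pc, m) = (Suc pc, snd (exec i (0, m)))" "i \<noteq> Halt"
    using Cons.prems(2) by (cases i; simp)+
  then have "step p (pc, m) = (Suc pc, snd (exec i (0, m)))"
    using Cons.prems(1) by simp
  with Cons.IH[of "Suc pc" "length c" "snd (exec i (0, m))"] Cons.prems show ?case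
    by (simp add: steps_Suc)
qed simp

text \<open>Cells below \<open>nvars\<close> hold variables, the cells from there up to \<open>mem_base\<close> hold intermediate
  results, and the remaining cells form one array. The number 1000 is an arbitrary bound on the
  nesting depth of the expressions used later; it does not depend on \<open>\<Delta>\<close>.\<close>

definition mem_base :: nat where "mem_base = 1000"
definition nvars :: nat where "nvars = 10"

text \<open>\<open>Sum\<close> is the only construct that loops: products, quotients, searches and
  cardinalities are all built from it. Its bound is evaluated once, before \<open>x\<close> changes,
  so time can be computed by recursion on the expression.\<close>

datatype exp =
    Num nat
  | Var nat
  | Arr exp
  | Plus exp exp
  | Minus exp exp
  | Sum nat exp exp

fun ev :: "exp \<Rightarrow> (nat \<Rightarrow> nat) \<Rightarrow> nat" where
  "ev (Num c) m = c"
| "ev (Var x) m = m x"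
| "ev (Arr e) m = m (mem_base + ev e m)"
| "ev (Plus a b) m = ev a m + ev b m"
| "ev (Minus a b) m = ev a m - ev b m"
| "ev (Sum x b e) m = (\<Sum>i<ev b m. ev e (m(x := i)))"

text \<open>Exact number of steps of the compiled code. For \<open>Sum\<close>: 4 steps of set-up, 7
  per pass besides the body (a test, five updates, a jump back), the final test, and 4 steps to
  restore \<open>x\<close> and deliver the result.\<close>

fun tm :: "exp \<Rightarrow> (nat \<Rightarrow> nat) \<Rightarrow> nat" where
  "tm (Num c) m = 1"
| "tm (Var x) m = 2"
| "tm (Arr e) m = tm e m + 3"
| "tm (Plus a b) m = tm a m + tm b m + 1"
| "tm (Minus a b) m = tm a m + tm b m + 1"
| "tm (Sum x b e) m = tm b m + 4 + ((\<Sum>i<ev b m. tm e (m(x := i)) + 7) + 1) + 4"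

fun wf_exp :: "exp \<Rightarrow> bool" where
  "wf_exp (Num c) = True"
| "wf_exp (Var x) = (x < nvars)"
| "wf_exp (Arr e) = wf_exp e"
| "wf_exp (Plus a b) = (wf_exp a \<and> wf_exp b)"
| "wf_exp (Minus a b) = (wf_exp a \<and> wf_exp b)"
| "wf_exp (Sum x b e) = (x < nvars \<and> wf_exp b \<and> wf_exp e)"

text \<open>\<open>fits e k\<close>: the registers \<open>k, k + 1, \<dots>\<close> that evaluating \<open>e\<close> into \<open>k\<close> overwrites
  all lie below \<^const>\<open>mem_base\<close>.\<close>

fun fits :: "exp \<Rightarrow> nat \<Rightarrow> bool" where
  "fits (Num c) k = (k < mem_base)"
| "fits (Var x) k = (k < mem_base)"
| "fits (Arr e) k = (fits e k \<and> k + 1 < mem_base)"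
| "fits (Plus a b) k = (fits a k \<and> fits b (k + 1))"
| "fits (Minus a b) k = (fits a k \<and> fits b (k + 1))"
| "fits (Sum x b e) k = (fits b k \<and> fits e (k + 3))"

text \<open>Kept apart from \<open>compile\<close> because addresses and jump targets must be known
  before the code in between is generated.\<close>

fun len :: "exp \<Rightarrow> nat" where
  "len (Num c) = 1"
| "len (Var x) = 2"
| "len (Arr e) = len e + 3"
| "len (Plus a b) = len a + len b + 1"
| "len (Minus a b) = len a + len b + 1"
| "len (Sum x b e) = len b + len e + 15"

text \<open>The registers below \<open>k\<close> act as a stack that is left as it was. In a
  \<open>Sum\<close>, \<open>k\<close> counts the passes down, \<open>k + 1\<close> accumulates,
  \<open>k + 2\<close> saves \<open>x\<close>, and the body is evaluated from \<open>k + 3\<close>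
  on; setting \<open>k + 3\<close> to 0 makes \<open>Jz\<close> an unconditional jump.\<close>

fun compile :: "exp \<Rightarrow> nat \<Rightarrow> nat \<Rightarrow> instr list" where
  "compile (Num c) k pc = [Const k c]"
| "compile (Var x) k pc = [Const k 0, Add k k x]"
| "compile (Arr e) k pc = compile e k pc @ [Const (k + 1) mem_base, Add k k (k + 1), Load k k]"
| "compile (Plus a b) k pc = compile a k pc @ compile b (k + 1) (pc + len a) @ [Add k k (k + 1)]"
| "compile (Minus a b) k pc = compile a k pc @ compile b (k + 1) (pc + len a) @ [Sub k k (k + 1)]"
| "compile (Sum x b e) k pc =
     compile b k pc @
     [Const (k + 1) 0, Const (k + 2) 0, Add (k + 2) (k + 2) x, Const x 0] @
     [Jz k (pc + len b + len e + 11)] @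
     compile e (k + 3) (pc + len b + 5) @
     [Add (k + 1) (k + 1) (k + 3), Const (k + 3) 1, Add x x (k + 3), Sub k k (k + 3),
      Const (k + 3) 0, Jz (k + 3) (pc + len b + 4)] @
     [Const x 0, Add x x (k + 2), Const k 0, Add k k (k + 1)]"

lemma length_compile [simp]: "length (compile e k pc) = len e"
  by (induction e arbitrary: k pc) simp_all

lemma fits_less: "fits e k \<Longrightarrow> k < mem_base"
  by (induction e arbitrary: k) auto

lemma fits_mono: "fits e k \<Longrightarrow> j \<le> k \<Longrightarrow> fits e j"
proof (induction e arbitrary: j k)
  case (Plus a b)
  then show ?case by (metis add_le_mono1 fits.simps(4))
next
  case (Minus a b)
  then show ?case by (metis add_le_mono1 fits.simps(5))
next
  case (Sum x b e)
  then show ?case by (metis add_le_mono1 fits.simps(6))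
qed auto


definition vis :: "nat \<Rightarrow> bool" where
  "vis a \<longleftrightarrow> a < nvars \<or> mem_base \<le> a"

text \<open>Expressions read variables and the array but never scratch registers, so whatever
  earlier evaluations leave there changes neither value nor time.\<close>

lemma ev_tm_cong:
  assumes "wf_exp e" "\<forall>a. vis a \<longrightarrow> m a = m' a"
  shows "ev e m = ev e m' \<and> tm e m = tm e m'"
  using assms
proof (induction e arbitrary: m m')
  case (Var x)
  then show ?case by (simp add: vis_def)
next
  case (Arr e)
  have "ev e m = ev e m' \<and> tm e m = tm e m'"
    using Arr.IH[of m m'] Arr.prems by (simp only: wf_exp.simps)
  moreover have "m (mem_base + ev e m') = m' (mem_base + ev e m')"
    using Arr.prems(2) by (simp add: vis_def)
  ultimately show ?case by simp
next
  case (Plus a b)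
  then have "ev a m = ev a m' \<and> tm a m = tm a m'" "ev b m = ev b m' \<and> tm b m = tm b m'"
    by (simp_all only: wf_exp.simps)
  then show ?case by simp
next
  case (Minus a b)
  then have "ev a m = ev a m' \<and> tm a m = tm a m'" "ev b m = ev b m' \<and> tm b m = tm b m'"
    by (simp_all only: wf_exp.simps)
  then show ?case by simp
next
  case (Sum x b e)
  have b: "ev b m = ev b m' \<and> tm b m = tm b m'"
    by (rule Sum.IH(1)) (use Sum.prems in auto)
  have "ev e (m(x := i)) = ev e (m'(x := i)) \<and> tm e (m(x := i)) = tm e (m'(x := i))" for i
    by (rule Sum.IH(2)) (use Sum.prems in auto)
  with b show ?case by simp
qed simp

lemmas ev_cong = ev_tm_cong[THEN conjunct1] and tm_cong = ev_tm_cong[THEN conjunct2]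

text \<open>Preserving the cells below \<open>k\<close> carries the induction: a first operand
  survives in \<open>k\<close> while the second is computed from \<open>k + 1\<close> on, and the
  variables, being below \<open>nvars\<close>, keep their values.\<close>

lemma compile_correct:
  assumes "wf_exp e" "nvars \<le> k" "fits e k" "code_at p pc (compile e k pc)"
  shows "\<exists>m'. steps p (tm e m) (pc, m) (pc + len e, m') \<and> m' k = ev e m \<and>
    (\<forall>a. a < k \<or> mem_base \<le> a \<longrightarrow> m' a = m a)"
  using assms
proof (induction e arbitrary: k pc m)
  case (Num c)
  have "steps p 1 (pc, m) (pc + 1, m(k := c))"
    using Num.prems by simp
  moreover have "(m(k := c)) k = c" "\<forall>a. a < k \<or> mem_base \<le> a \<longrightarrow> (m(k := c)) a = m a"
    using Num.prems by auto
  ultimately show ?case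
    unfolding tm.simps len.simps ev.simps by blast
next
  case (Var x)
  let ?m' = "m(k := m x)"
  have "steps p 2 (pc, m) (pc + 2, ?m')"
    using steps_straight[of p pc "[Const k 0, Add k k x]" 2 m] Var.prems
    by auto
  moreover have "?m' k = m x" "\<forall>a. a < k \<or> mem_base \<le> a \<longrightarrow> ?m' a = m a"
    using Var.prems by auto
  ultimately show ?case
    unfolding tm.simps len.simps ev.simps by blast
next
  case (Arr e)
  have "wf_exp e" "nvars \<le> k" "fits e k" "code_at p pc (compile e k pc)"
    using Arr.prems by simp_all
  from Arr.IH[OF this, of m] obtain m1 where m1: "steps p (tm e m) (pc, m) (pc + len e, m1)" "m1 k = ev e m"
    "\<And>a. a < k \<or> mem_base \<le> a \<Longrightarrow> m1 a = m a"
    by blast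
  let ?c = "[Const (k + 1) mem_base, Add k k (k + 1), Load k k]"
  let ?m2 = "exec_list ?c m1"
  have k: "k + 1 < mem_base" using Arr.prems by simp
  have m2: "?m2 = m1(k + 1 := mem_base, k := m (mem_base + ev e m))"
    using m1(2,3) k by (simp add: add.commute)
  have "steps p 3 (pc + len e, m1) (pc + len e + 3, ?m2)"
    using steps_straight[of p "pc + len e" ?c 3 m1] Arr.prems by simp
  from steps_trans[OF m1(1) this]
  have "steps p (tm (Arr e) m) (pc, m) (pc + len (Arr e), ?m2)"
    by (simp add: add.assoc)
  moreover have "?m2 k = ev (Arr e) m" "\<forall>a. a < k \<or> mem_base \<le> a \<longrightarrow> ?m2 a = m a"
    unfolding m2 using m1(3) k by auto
  ultimately show ?case by blast
next
  case (Plus a b)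
  have "wf_exp a" "nvars \<le> k" "fits a k" "code_at p pc (compile a k pc)"
    using Plus.prems by simp_all
  from Plus.IH(1)[OF this, of m] obtain m1 where m1: "steps p (tm a m) (pc, m) (pc + len a, m1)" "m1 k = ev a m"
    "\<And>a. a < k \<or> mem_base \<le> a \<Longrightarrow> m1 a = m a"
    by blast
  have eq: "ev b m1 = ev b m" "tm b m1 = tm b m"
    using Plus.prems m1(3) by (auto intro!: ev_cong tm_cong simp: vis_def)
  have "wf_exp b" "nvars \<le> k + 1" "fits b (k + 1)"
    "code_at p (pc + len a) (compile b (k + 1) (pc + len a))"
    using Plus.prems by simp_all
  from Plus.IH(2)[OF this, of m1] obtain m2 where m2: "steps p (tm b m1) (pc + len a, m1) (pc + len a + len b, m2)"
    "m2 (k + 1) = ev b m1" "\<And>a. a < k + 1 \<or> mem_base \<le> a \<Longrightarrow> m2 a = m1 a"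
    by blast
  let ?m3 = "m2(k := ev a m + ev b m)"
  have k: "k < mem_base" using Plus.prems fits_less by auto
  have "m2 k = ev a m" using m1(2) m2(3) by simp
  then have "steps p 1 (pc + len a + len b, m2) (pc + len a + len b + 1, ?m3)"
    using steps_straight[of p "pc + len a + len b" "[Add k k (k + 1)]" 1 m2] Plus.prems m2(2) eq
    by simp
  from steps_trans[OF steps_trans[OF m1(1) m2(1)] this]
  have "steps p (tm (Plus a b) m) (pc, m) (pc + len (Plus a b), ?m3)"
    by (simp add: add.assoc eq)
  moreover have "?m3 k = ev (Plus a b) m" "\<forall>a. a < k \<or> mem_base \<le> a \<longrightarrow> ?m3 a = m a"
    using m1(3) m2(3) k by auto
  ultimately show ?case by blast
next
  case (Minus a b)
  have "wf_exp a" "nvars \<le> k" "fits a k" "code_at p pc (compile a k pc)"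
    using Minus.prems by simp_all
  from Minus.IH(1)[OF this, of m] obtain m1 where m1: "steps p (tm a m) (pc, m) (pc + len a, m1)" "m1 k = ev a m"
    "\<And>a. a < k \<or> mem_base \<le> a \<Longrightarrow> m1 a = m a"
    by blast
  have eq: "ev b m1 = ev b m" "tm b m1 = tm b m"
    using Minus.prems m1(3) by (auto intro!: ev_cong tm_cong simp: vis_def)
  have "wf_exp b" "nvars \<le> k + 1" "fits b (k + 1)"
    "code_at p (pc + len a) (compile b (k + 1) (pc + len a))"
    using Minus.prems by simp_all
  from Minus.IH(2)[OF this, of m1] obtain m2 where m2: "steps p (tm b m1) (pc + len a, m1) (pc + len a + len b, m2)"
    "m2 (k + 1) = ev b m1" "\<And>a. a < k + 1 \<or> mem_base \<le> a \<Longrightarrow> m2 a = m1 a"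
    by blast
  let ?m3 = "m2(k := ev a m - ev b m)"
  have k: "k < mem_base" using Minus.prems fits_less by auto
  have "m2 k = ev a m" using m1(2) m2(3) by simp
  then have "steps p 1 (pc + len a + len b, m2) (pc + len a + len b + 1, ?m3)"
    using steps_straight[of p "pc + len a + len b" "[Sub k k (k + 1)]" 1 m2] Minus.prems m2(2) eq
    by simp
  from steps_trans[OF steps_trans[OF m1(1) m2(1)] this]
  have "steps p (tm (Minus a b) m) (pc, m) (pc + len (Minus a b), ?m3)"
    by (simp add: add.assoc eq)
  moreover have "?m3 k = ev (Minus a b) m" "\<forall>a. a < k \<or> mem_base \<le> a \<longrightarrow> ?m3 a = m a"
    using m1(3) m2(3) k by auto
  ultimately show ?case by blast
next
  case (Sum x b e)
  let ?pl = "pc + len b + 4"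
  let ?pe = "pc + len b + len e + 11"
  have x: "x < k" using Sum.prems by simp
  have k3: "k + 3 < mem_base" using Sum.prems fits_less[of e "k + 3"] by simp
  let ?c1 = "[Const (k + 1) 0, Const (k + 2) 0, Add (k + 2) (k + 2) x, Const x 0]"
  let ?c2 = "[Add (k + 1) (k + 1) (k + 3), Const (k + 3) 1, Add x x (k + 3),
       Sub k k (k + 3), Const (k + 3) 0]"
  let ?c3 = "[Const x 0, Add x x (k + 2), Const k 0, Add k k (k + 1)]"
  have eqs: "pc + len b + 5 = ?pl + 1" "?pe = ?pl + 1 + len e + 5 + 1"
    by simp_all
  have lens: "length ?c1 = 4" "length ?c2 = 5" "length [Jz k l] = 1" "length [Jz (k + 3) l] = 1"
    for l by simp_all
  have "code_at p pc (compile b k pc @ ?c1 @ [Jz k ?pe] @ compile e (k + 3) (pc + len b + 5) @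
      ?c2 @ [Jz (k + 3) ?pl] @ ?c3)"
    using Sum.prems(4) by simp
  then have code: "code_at p pc (compile b k pc)" "code_at p (pc + len b) ?c1"
    "code_at p ?pl [Jz k ?pe]" "code_at p (?pl + 1) (compile e (k + 3) (?pl + 1))"
    "code_at p (?pl + 1 + len e) ?c2" "code_at p (?pl + 1 + len e + 5) [Jz (k + 3) ?pl]"
    "code_at p ?pe ?c3"
    unfolding code_at_append length_compile lens eqs by blast+
  have "wf_exp b" "nvars \<le> k" "fits b k"
    using Sum.prems by simp_all
  from Sum.IH(1)[OF this code(1), of m] obtain m1 where m1: "steps p (tm b m) (pc, m) (pc + len b, m1)" "m1 k = ev b m"
    "\<And>a. a < k \<or> mem_base \<le> a \<Longrightarrow> m1 a = m a"
    by blast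
  define mi where "mi = m1(k + 1 := 0, k + 2 := m x, x := 0)"
  have "exec_list ?c1 m1 = mi"
    using m1(3)[of x] x by (auto simp: fun_eq_iff mi_def)
  then have s2: "steps p 4 (pc + len b, m1) (?pl, mi)"
    using steps_straight[OF code(2), of 4 m1] by simp
  \<comment> \<open>Loop invariant with \<open>r\<close> passes left and \<open>i\<close> as the
    current index. Among the cells that the body can see, only \<open>x\<close> may differ from the
    initial memory.\<close>
  have loop: "\<exists>m3. steps p ((\<Sum>j=i..<i+r. tm e (m(x := j)) + 7) + 1) (?pl, m2) (?pe, m3) \<and>
      m3 (k + 1) = m2 (k + 1) + (\<Sum>j=i..<i+r. ev e (m(x := j))) \<and> m3 (k + 2) = m2 (k + 2) \<and>
      (\<forall>a. a \<noteq> x \<and> (a < k \<or> mem_base \<le> a) \<longrightarrow> m3 a = m a)"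
    if "m2 k = r" "m2 x = i" "\<And>a. a \<noteq> x \<and> (a < k \<or> mem_base \<le> a) \<Longrightarrow> m2 a = m a"
    for r i m2
    using that
  proof (induction r arbitrary: i m2)
    case 0
    have "steps p 1 (?pl, m2) (?pe, m2)"
      using code(3) 0 by simp
    then show ?case
      using 0 by (intro exI[of _ m2]) auto
  next
    case (Suc r)
    have s1: "steps p 1 (?pl, m2) (?pl + 1, m2)"
      using code(3) Suc.prems(1) by simp
    have "wf_exp e" "nvars \<le> k + 3" "fits e (k + 3)"
      using Sum.prems by simp_all
    from Sum.IH(2)[OF this code(4), of m2] obtain m3 where m3: "steps p (tm e m2) (?pl + 1, m2) (?pl + 1 + len e, m3)"
      "m3 (k + 3) = ev e m2" "\<And>a. a < k + 3 \<or> mem_base \<le> a \<Longrightarrow> m3 a = m2 a"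
      by blast
    have eq: "ev e m2 = ev e (m(x := i))" "tm e m2 = tm e (m(x := i))"
      by (rule ev_cong tm_cong; use Sum.prems Suc.prems in \<open>auto simp: vis_def\<close>)+
    let ?m4 = "m3(k + 1 := m2 (k + 1) + ev e (m(x := i)), x := Suc i, k := r, k + 3 := 0)"
    have "m3 x = i" "m3 k = Suc r" "m3 (k + 1) = m2 (k + 1)"
      using m3(3) Suc.prems x by auto
    then have "exec_list ?c2 m3 = ?m4"
      using m3(2) eq x by (auto simp: fun_eq_iff)
    then have s4: "steps p 5 (?pl + 1 + len e, m3) (?pl + 1 + len e + 5, ?m4)"
      using steps_straight[OF code(5), of 5 m3] by simp
    have s5: "steps p 1 (?pl + 1 + len e + 5, ?m4) (?pl, ?m4)"
      using code(6) by simp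
    have "?m4 k = r" "?m4 x = Suc i" using x by auto
    moreover have "?m4 a = m a" if "a \<noteq> x \<and> (a < k \<or> mem_base \<le> a)" for a
      using that m3(3)[of a] Suc.prems(3)[of a] k3 by auto
    ultimately obtain m5 where m5:
      "steps p ((\<Sum>j=Suc i..<Suc i+r. tm e (m(x := j)) + 7) + 1) (?pl, ?m4) (?pe, m5)"
      "m5 (k + 1) = ?m4 (k + 1) + (\<Sum>j=Suc i..<Suc i+r. ev e (m(x := j)))"
      "m5 (k + 2) = ?m4 (k + 2)"
      "\<And>a. a \<noteq> x \<and> (a < k \<or> mem_base \<le> a) \<Longrightarrow> m5 a = m a"
      using Suc.IH[of ?m4 "Suc i"] by blast
    have split: "(\<Sum>j=i..<i+Suc r. f j) = f i + (\<Sum>j=Suc i..<Suc i+r. f j)"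
      for f :: "nat \<Rightarrow> nat"
      by (simp add: sum.atLeast_Suc_lessThan)
    have time: "1 + tm e m2 + 5 + 1 + ((\<Sum>j=Suc i..<Suc i+r. tm e (m(x := j)) + 7) + 1) =
        (\<Sum>j=i..<i+Suc r. tm e (m(x := j)) + 7) + 1"
      unfolding split eq by simp
    have "steps p ((\<Sum>j=i..<i+Suc r. tm e (m(x := j)) + 7) + 1) (?pl, m2) (?pe, m5)"
      using steps_trans[OF steps_trans[OF steps_trans[OF steps_trans[OF s1 m3(1)] s4] s5] m5(1)]
      unfolding time .
    moreover have "m5 (k + 1) = m2 (k + 1) + (\<Sum>j=i..<i+Suc r. ev e (m(x := j)))"
      unfolding split using m5(2) x by simp
    moreover have "m5 (k + 2) = m2 (k + 2)"
      using m5(3) m3(3)[of "k + 2"] x by simp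
    ultimately show ?case using m5(4) by blast
  qed
  have "mi k = ev b m" "mi x = 0"
    "\<And>a. a \<noteq> x \<and> (a < k \<or> mem_base \<le> a) \<Longrightarrow> mi a = m a"
    "mi (k + 1) = 0" "mi (k + 2) = m x"
    using m1 x k3 by (auto simp: mi_def)
  note mi = this
  from loop[OF mi(1-3)] obtain m3 where m3:
    "steps p ((\<Sum>j<ev b m. tm e (m(x := j)) + 7) + 1) (?pl, mi) (?pe, m3)"
    "m3 (k + 1) = (\<Sum>j<ev b m. ev e (m(x := j)))" "m3 (k + 2) = m x"
    "\<And>a. a \<noteq> x \<and> (a < k \<or> mem_base \<le> a) \<Longrightarrow> m3 a = m a"
    unfolding mi(4,5) add_0 atLeast0LessThan by blast
  define mf where "mf = m3(x := m x, k := m3 (k + 1))"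
  have "exec_list ?c3 m3 = mf"
    using m3(3) x by (auto simp: fun_eq_iff mf_def)
  then have s4: "steps p 4 (?pe, m3) (?pe + 4, mf)"
    using steps_straight[OF code(7), of 4 m3] by simp
  have "\<forall>a. a < k \<or> mem_base \<le> a \<longrightarrow> mf a = m a"
    using m3(4) k3 by (auto simp: mf_def)
  moreover have "mf k = ev (Sum x b e) m"
    using m3(2) by (simp add: mf_def)
  moreover have "steps p (tm (Sum x b e) m) (pc, m) (pc + len (Sum x b e), mf)"
    using steps_trans[OF steps_trans[OF steps_trans[OF m1(1) s2] m3(1)] s4]
    by (simp add: add.assoc)
  ultimately show ?case by blast
qed


section \<open>Optimal paths have local costs\<close>

locale secluded =
  fixes n :: nat and E :: "nat \<Rightarrow> nat \<Rightarrow> bool" and s t \<Delta> :: nat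
  assumes graph: "simple_graph n E" and deg: "max_degree_le n E \<Delta>"
    and s_less: "s < n" and t_less: "t < n"
begin

abbreviation "Nb \<equiv> closed_nbh n E"
abbreviation "NS \<equiv> closed_nbh_set n E"

text \<open>Rerouting from position \<open>i\<close> to position \<open>j\<close> through
  \<open>x\<close> uncovers the positions \<open>i + 2\<close> to \<open>j - 2\<close>, which are
  \<open>j - i - 3\<close> vertices, while \<open>x\<close> covers at most
  \<open>\<Delta> + 1\<close>. The exchange costs nothing once
  \<open>j > i + \<Delta> + 3\<close>.\<close>

definition K :: nat where "K = \<Delta> + 3"

lemma E_sym: "u < n \<Longrightarrow> v < n \<Longrightarrow> E u v \<Longrightarrow> E v u"
  using graph by (simp add: simple_graph_def)

lemma Nb_subset: "u < n \<Longrightarrow> Nb u \<subseteq> {..<n}"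
  by (auto simp: closed_nbh_def)

lemma NS_subset: "S \<subseteq> {..<n} \<Longrightarrow> NS S \<subseteq> {..<n}"
  using Nb_subset by (fastforce simp: closed_nbh_set_def)

lemma finite_Nb [simp]: "finite (Nb u)"
  by (simp add: closed_nbh_def)

lemma finite_NS [simp]: "finite S \<Longrightarrow> finite (NS S)"
  by (simp add: closed_nbh_set_def)

lemma card_Nb: "u < n \<Longrightarrow> card (Nb u) \<le> \<Delta> + 1"
  using deg card_insert_le_m1[of "Suc \<Delta>" "{v. v < n \<and> E u v}" u]
  by (simp add: max_degree_le_def closed_nbh_def)

lemma NS_mono: "A \<subseteq> B \<Longrightarrow> NS A \<subseteq> NS B"
  by (auto simp: closed_nbh_set_def)

lemma NS_insert: "NS (insert x A) = Nb x \<union> NS A"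
  by (auto simp: closed_nbh_set_def)

lemma NS_empty [simp]: "NS {} = {}"
  by (simp add: closed_nbh_set_def)

lemma is_path_iff:
  "is_path n E a b P \<longleftrightarrow> P \<noteq> [] \<and> hd P = a \<and> last P = b \<and> distinct P \<and>
     set P \<subseteq> {..<n} \<and> successively E P"
  by (auto simp: is_path_def successively_conv_nth)

text \<open>Detours are treated as reachability inside a vertex set. A simple path is extracted
  afterwards by \<open>rtrancl_path\<close>, so no spliced vertex list has to be shown
  distinct.\<close>

definition adj_on :: "nat set \<Rightarrow> (nat \<times> nat) set" where
  "adj_on S = {(u, v). u \<in> S \<and> v \<in> S \<and> u < n \<and> v < n \<and> E u v}"

lemma adj_on_mono: "A \<subseteq> B \<Longrightarrow> adj_on A \<subseteq> adj_on B"
  by (auto simp: adj_on_def)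

lemma walk_rtrancl:
  assumes "P \<noteq> []" "successively E P" "set P \<subseteq> S" "set P \<subseteq> {..<n}"
  shows "(hd P, last P) \<in> (adj_on S)\<^sup>*"
  using assms
proof (induction P rule: induct_list012)
  case (3 x y zs)
  then have "(x, y) \<in> adj_on S" "(hd (y # zs), last (y # zs)) \<in> (adj_on S)\<^sup>*"
    by (auto simp: adj_on_def)
  then show ?case by (simp add: converse_rtrancl_into_rtrancl)
qed auto

lemma rtrancl_path:
  assumes "(a, b) \<in> (adj_on S)\<^sup>*" "a \<in> S" "a < n"
  shows "\<exists>Q. is_path n E a b Q \<and> set Q \<subseteq> S"
  using assms(1)
proof (induction rule: rtrancl_induct)
  case base
  show ?case
    by (rule exI[of _ "[a]"]) (use assms in \<open>simp add: is_path_iff\<close>)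
next
  case (step u v)
  then obtain Q where Q: "is_path n E a u Q" "set Q \<subseteq> S" by blast
  show ?case
  proof (cases "v \<in> set Q")
    case True
    then obtain xs ys where "Q = xs @ v # ys" by (meson split_list)
    then have "is_path n E a v (xs @ [v])" "set (xs @ [v]) \<subseteq> S"
      using Q by (auto simp: is_path_iff successively_append_iff hd_append)
    then show ?thesis by blast
  next
    case False
    then have "is_path n E a v (Q @ [v])" "set (Q @ [v]) \<subseteq> S"
      using Q step.hyps(2) by (auto simp: is_path_iff successively_append_iff adj_on_def)
    then show ?thesis by blast
  qed
qed

section \<open>Exchange arguments on shortest optimal paths\<close>

definition shortest_optimal :: "nat list \<Rightarrow> bool" where
  "shortest_optimal P \<longleftrightarrow> optimal_secluded_path n E s t P \<and>
     (\<forall>Q. optimal_secluded_path n E s t Q \<longrightarrow> length P \<le> length Q)"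

lemma ex_shortest_optimal:
  assumes "is_path n E s t P"
  shows "\<exists>P. shortest_optimal P"
proof -
  obtain P1 where "optimal_secluded_path n E s t P1"
    using ex_has_least_nat[of "is_path n E s t" P "path_cost n E"] assms
    unfolding optimal_secluded_path_def by blast
  then show ?thesis
    using ex_has_least_nat[of "optimal_secluded_path n E s t" P1 length]
    unfolding shortest_optimal_def by blast
qed

text \<open>Otherwise a path inside \<open>S\<close> would be optimal, costing at most
  \<open>card (NS S)\<close>, and would have at most \<open>card S\<close> vertices, fewer than
  \<open>P\<close>.\<close>

lemma shortcut:
  assumes P: "shortest_optimal P" and S: "finite S" "s \<in> S"
    and conn: "(s, t) \<in> (adj_on S)\<^sup>*" and less: "card S < length P"
  shows "path_cost n E P < card (NS S)"
proof (rule ccontr)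
  assume "\<not> ?thesis"
  then have le: "card (NS S) \<le> path_cost n E P" by simp
  obtain Q where Q: "is_path n E s t Q" "set Q \<subseteq> S"
    using rtrancl_path[OF conn S(2) s_less] by blast
  have "path_cost n E Q \<le> card (NS S)"
    unfolding path_cost_def by (intro card_mono NS_mono finite_NS S Q)
  with le Q P have "optimal_secluded_path n E s t Q"
    unfolding shortest_optimal_def optimal_secluded_path_def by (meson order_trans)
  then have "length P \<le> length Q"
    using P by (simp add: shortest_optimal_def)
  moreover have "length Q \<le> card S"
    using Q S card_mono[of S "set Q"] by (simp add: is_path_iff distinct_card)
  ultimately show False using less by simp
qed

context
  fixes P
  assumes so: "shortest_optimal P"
begin

lemma P_path: "P \<noteq> []" "hd P = s" "last P = t" "distinct P" "set P \<subseteq> {..<n}" "successively E P"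
  using so by (auto simp: shortest_optimal_def optimal_secluded_path_def is_path_iff)

lemma prefix_conn:
  assumes "i < length P"
  shows "(s, P ! i) \<in> (adj_on (set (take (Suc i) P)))\<^sup>*"
proof -
  let ?A = "take (Suc i) P"
  have "?A \<noteq> []" using P_path(1) by simp
  moreover have "successively E ?A"
    using P_path(6) by (metis append_take_drop_id successively_append_iff)
  moreover have "set ?A \<subseteq> {..<n}" using P_path(5) set_take_subset by fastforce
  ultimately have "(hd ?A, last ?A) \<in> (adj_on (set ?A))\<^sup>*"
    by (intro walk_rtrancl) auto
  moreover have "hd ?A = s" using P_path by (simp add: hd_take)
  moreover have "last ?A = P ! i" using assms by (simp add: take_Suc_conv_app_nth)
  ultimately show ?thesis by simp
qed

lemma suffix_conn:
  assumes "j < length P"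
  shows "(P ! j, t) \<in> (adj_on (set (drop j P)))\<^sup>*"
proof -
  let ?A = "drop j P"
  have "?A \<noteq> []" using assms by simp
  moreover have "successively E ?A"
    using P_path(6) by (metis append_take_drop_id successively_append_iff)
  moreover have "set ?A \<subseteq> {..<n}" using P_path(5) set_drop_subset by fastforce
  ultimately have "(hd ?A, last ?A) \<in> (adj_on (set ?A))\<^sup>*"
    by (intro walk_rtrancl) auto
  moreover have "hd ?A = P ! j" using assms by (simp add: hd_drop_conv_nth)
  moreover have "last ?A = t" using assms P_path by simp
  ultimately show ?thesis by simp
qed

lemma s_in_prefix: "s \<in> set (take (Suc i) P)"
  using P_path by (cases P) auto

lemma in_prefix: "i < length P \<Longrightarrow> P ! i \<in> set (take (Suc i) P)"
  by (simp add: take_Suc_conv_app_nth)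

lemma in_suffix: "j < length P \<Longrightarrow> P ! j \<in> set (drop j P)"
  by (metis Cons_nth_drop_Suc list.set_intros(1))

lemma P_less: "i < length P \<Longrightarrow> P ! i < n"
  using P_path(5) nth_mem by blast

lemma card_prefix_suffix:
  "card (set (take (Suc i) P) \<union> set (drop j P)) \<le> Suc i + (length P - j)"
proof -
  have "card (set (take (Suc i) P) \<union> set (drop j P)) \<le>
      card (set (take (Suc i) P)) + card (set (drop j P))"
    by (rule card_Un_le)
  also have "\<dots> \<le> length (take (Suc i) P) + length (drop j P)"
    by (intro add_mono card_length)
  finally show ?thesis by simp
qed

text \<open>A chord joins a prefix and a suffix of \<open>P\<close> into a smaller connecting subset
  of \<open>set P\<close>, whose closed neighbourhood cannot be larger; this contradicts
  \<open>shortcut\<close>.\<close>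

lemma induced:
  assumes "Suc a < b" "b < length P"
  shows "\<not> E (P ! a) (P ! b)"
proof
  assume edge: "E (P ! a) (P ! b)"
  let ?A = "set (take (Suc a) P)" and ?B = "set (drop b P)"
  have "(s, P ! a) \<in> (adj_on (?A \<union> ?B))\<^sup>*"
    using prefix_conn[of a] assms rtrancl_mono[OF adj_on_mono[of ?A "?A \<union> ?B"]] by auto
  moreover have "(P ! a, P ! b) \<in> adj_on (?A \<union> ?B)"
    using edge assms P_less in_prefix in_suffix by (auto simp: adj_on_def)
  moreover have "(P ! b, t) \<in> (adj_on (?A \<union> ?B))\<^sup>*"
    using suffix_conn[of b] assms rtrancl_mono[OF adj_on_mono[of ?B "?A \<union> ?B"]] by auto
  ultimately have "(s, t) \<in> (adj_on (?A \<union> ?B))\<^sup>*" by auto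
  moreover have "card (?A \<union> ?B) < length P"
    using card_prefix_suffix[of a b] assms by linarith
  ultimately have "path_cost n E P < card (NS (?A \<union> ?B))"
    using shortcut[OF so] s_in_prefix by simp
  moreover have "card (NS (?A \<union> ?B)) \<le> path_cost n E P"
    unfolding path_cost_def
    by (intro card_mono NS_mono finite_NS) (auto dest: in_set_takeD in_set_dropD)
  ultimately show False by simp
qed

text \<open>Going through a common neighbour \<open>x\<close> of two far apart vertices adds at most \<open>\<Delta> + 1\<close>
  vertices to the closed neighbourhood, and it drops all inner vertices that are skipped.\<close>

lemma window:
  assumes i: "i + K < j" and j: "j < length P" and xi: "x \<in> Nb (P ! i)" and xj: "x \<in> Nb (P ! j)"
  shows False
proof -
  let ?A = "set (take (Suc i) P)" and ?B = "set (drop j P)"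
  let ?S = "insert x (?A \<union> ?B)"
  have il: "i < length P" using i j by simp
  have x: "x < n" using xi il P_less Nb_subset by blast
  have 1: "(s, P ! i) \<in> (adj_on ?S)\<^sup>*"
    using prefix_conn[OF il] rtrancl_mono[OF adj_on_mono[of ?A ?S]] by auto
  have "P ! i = x \<or> (P ! i, x) \<in> adj_on ?S"
    using xi x P_less[OF il] in_prefix[OF il] by (auto simp: closed_nbh_def adj_on_def)
  then have 2: "(P ! i, x) \<in> (adj_on ?S)\<^sup>*" by auto
  have "P ! j = x \<or> (x, P ! j) \<in> adj_on ?S"
    using xj x P_less[OF j] in_suffix[OF j] E_sym by (auto simp: closed_nbh_def adj_on_def)
  then have 3: "(x, P ! j) \<in> (adj_on ?S)\<^sup>*" by auto
  have 4: "(P ! j, t) \<in> (adj_on ?S)\<^sup>*"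
    using suffix_conn[OF j] rtrancl_mono[OF adj_on_mono[of ?B ?S]] by auto
  have conn: "(s, t) \<in> (adj_on ?S)\<^sup>*" using 1 2 3 4 by (meson rtrancl_trans)
  have "card ?S \<le> Suc (card (?A \<union> ?B))" by (rule card_insert_le_m1) auto
  then have "card ?S < length P"
    using card_prefix_suffix[of i j] i j by (simp add: K_def)
  then have less: "path_cost n E P < card (NS ?S)"
    using shortcut[OF so _ _ conn] s_in_prefix by simp
  \<comment> \<open>Positions \<open>i + 1\<close> and \<open>j - 1\<close> are left out: they are
    neighbours of the retained \<open>P ! i\<close> and \<open>P ! j\<close> and stay
    covered.\<close>
  let ?J = "(!) P ` {i + 2..<j - 1}"
  have "inj_on ((!) P) {i + 2..<j - 1}"
    using P_path(4) j by (auto simp: inj_on_def nth_eq_iff_index_eq)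
  then have cJ: "card ?J = j - i - 3" by (simp add: card_image)
  have "?J \<subseteq> set P" using j by auto
  moreover have "set P \<subseteq> NS (set P)" by (auto simp: closed_nbh_set_def closed_nbh_def)
  ultimately have JP: "?J \<subseteq> NS (set P)" by blast
  \<comment> \<open>A skipped position of \<open>?J\<close> and a retained one are at least two
    apart, so an edge between them would be a chord.\<close>
  have out: "P ! c \<notin> Nb (P ! a)" if "c \<in> {i + 2..<j - 1}" "a \<le> i \<or> j \<le> a" "a < length P" for a c
  proof -
    have "P ! c \<noteq> P ! a" using that j P_path(4) by (auto simp: nth_eq_iff_index_eq)
    moreover have "\<not> E (P ! a) (P ! c)"
    proof (cases "a \<le> i")
      case True
      moreover have "Suc a < c" "c < length P" using True that(1) j by auto
      ultimately show ?thesis using induced[of a c] by simp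
    next
      case False
      then have "Suc c < a" "c < length P" using that j by auto
      then show ?thesis
        using induced[of c a] that(3) E_sym[of "P ! a" "P ! c"] P_less by auto
    qed
    ultimately show ?thesis by (simp add: closed_nbh_def)
  qed
  have "NS (?A \<union> ?B) \<inter> ?J = {}"
  proof -
    have "\<exists>a<length P. (a \<le> i \<or> j \<le> a) \<and> y = P ! a" if "y \<in> ?A \<union> ?B" for y
      using that
    proof
      assume "y \<in> ?A"
      then obtain a where "a < length P" "a \<le> i" "y = P ! a"
        by (auto simp: in_set_conv_nth)
      then show ?thesis by blast
    next
      assume "y \<in> ?B"
      then obtain a where "a < length P - j" "y = P ! (j + a)"
        by (auto simp: in_set_conv_nth)
      then show ?thesis by (intro exI[of _ "j + a"]) auto
    qed
    with out show ?thesis by (fastforce simp: closed_nbh_set_def)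
  qed
  moreover have "NS (?A \<union> ?B) \<subseteq> NS (set P)"
    by (intro NS_mono) (auto dest: in_set_takeD in_set_dropD)
  ultimately have "NS ?S \<subseteq> (NS (set P) - ?J) \<union> Nb x"
    unfolding NS_insert by blast
  then have "card (NS ?S) \<le> card ((NS (set P) - ?J) \<union> Nb x)"
    by (intro card_mono) auto
  also have "\<dots> \<le> card (NS (set P) - ?J) + card (Nb x)"
    by (rule card_Un_le)
  also have "\<dots> \<le> card (NS (set P)) - (j - i - 3) + (\<Delta> + 1)"
    using card_Nb[OF x] card_Diff_subset[OF finite_imageI[OF finite_atLeastLessThan] JP]
    unfolding cJ by linarith
  also have "\<dots> \<le> card (NS (set P))"
  proof -
    have "j - i - 3 \<le> card (NS (set P))"
      using card_mono[OF finite_NS[OF finite_set] JP] unfolding cJ .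
    then show ?thesis using i by (simp add: K_def)
  qed
  finally show False using less by (simp add: path_cost_def)
qed

end

section \<open>The cost of a walk as a sum of local charges\<close>

text \<open>One list is read in two ways: as a path from \<open>s\<close> to \<open>t\<close>, and,
  newest vertex first, as a walk from \<open>t\<close> to \<open>s\<close>. Under the second reading
  \<open>take K P\<close> holds the vertices visited just before \<open>v\<close>.\<close>

fun window_cost :: "nat list \<Rightarrow> nat" where
  "window_cost [] = 0"
| "window_cost (v # P) = window_cost P + card (Nb v - NS (set (take K P)))"

lemma window_cost_ge: "card (NS (set P)) \<le> window_cost P"
proof (induction P)
  case (Cons v P)
  have "NS (set (v # P)) \<subseteq> NS (set P) \<union> (Nb v - NS (set (take K P)))"
    using NS_mono[OF set_take_subset, of K P] by (auto simp: NS_insert)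
  then have "card (NS (set (v # P))) \<le> card (NS (set P) \<union> (Nb v - NS (set (take K P))))"
    by (intro card_mono) auto
  also have "\<dots> \<le> card (NS (set P)) + card (Nb v - NS (set (take K P)))"
    by (rule card_Un_le)
  finally show ?case using Cons by simp
qed simp

lemma window_cost_shortest_optimal:
  assumes so: "shortest_optimal P"
  shows "window_cost P = path_cost n E P"
proof -
  \<comment> \<open>Stated for all suffixes \<open>R\<close> while keeping the prefix
    \<open>A\<close>, because \<open>window\<close> speaks about positions in the whole of
    \<open>P\<close>.\<close>
  have "window_cost R = card (NS (set R))" if "P = A @ R" for A R
    using that
  proof (induction R arbitrary: A)
    case (Cons v R)
    have IH: "window_cost R = card (NS (set R))" using Cons.IH[of "A @ [v]"] Cons.prems by simp
    have "Nb v - NS (set R) = Nb v - NS (set (take K R))"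
    proof -
      have False if x: "x \<in> Nb v" "x \<in> NS (set R)" "x \<notin> NS (set (take K R))" for x
      proof -
        obtain b where b: "b < length R" "x \<in> Nb (R ! b)"
          using x(2) by (auto simp: closed_nbh_set_def in_set_conv_nth)
        \<comment> \<open>No vertex of the window covers \<open>x\<close>, so the covering vertex
          lies at least \<open>K\<close> entries into \<open>R\<close>, hence more than
          \<open>K\<close> positions after \<open>v\<close>, which \<open>window\<close>
          forbids.\<close>
        have "K \<le> b"
        proof (rule ccontr)
          assume "\<not> K \<le> b"
          then have "R ! b \<in> set (take K R)"
            using b(1) by (auto simp: in_set_conv_nth intro!: exI[of _ b])
          with b(2) x(3) show False by (auto simp: closed_nbh_set_def)
        qed
        moreover have "P ! length A = v" "P ! (length A + Suc b) = R ! b"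
          using Cons.prems by (auto simp: nth_append)
        ultimately show False
          using window[OF so, of "length A" "length A + Suc b" x] x(1) b Cons.prems by simp
      qed
      moreover have "NS (set (take K R)) \<subseteq> NS (set R)"
        by (rule NS_mono[OF set_take_subset])
      ultimately show ?thesis by blast
    qed
    moreover have "NS (set (v # R)) = NS (set R) \<union> (Nb v - NS (set R))"
      by (auto simp: NS_insert)
    then have "card (NS (set (v # R))) = card (NS (set R)) + card (Nb v - NS (set R))"
      by (metis Diff_disjoint card_Un_disjoint finite_Diff finite_NS finite_Nb finite_set)
    ultimately show ?case using IH by simp
  qed simp
  then show ?thesis by (simp add: path_cost_def)
qed

section \<open>Numbering the windowed walks\<close>

definition N :: nat where "N = n ^ K"
definition dig :: "nat \<Rightarrow> nat \<Rightarrow> nat" where "dig q i = q div n ^ i mod n"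
definition w :: "nat \<Rightarrow> nat \<Rightarrow> nat" where
  "w q v = card (Nb v - (\<Union>i<K. Nb (dig q i)))"
text \<open>Multiplying by \<open>n\<close> and adding \<open>v\<close> shifts the window, and
  \<open>mod N\<close> drops its oldest vertex. Above the window a unit of cost counts
  \<open>n\<close> and each further vertex counts 1.\<close>

definition nxt :: "nat \<Rightarrow> nat \<Rightarrow> nat" where
  "nxt q v = (q div N + n * w q v + 1) * N + (q * n + v) mod N"
fun rep :: "nat \<Rightarrow> nat" where
  "rep 0 = 0"
| "rep (Suc i) = rep i * n + t"
definition init :: nat where "init = n * card (Nb t) * N + rep K"

text \<open>Walks are listed newest vertex first. The first window is padded with copies of \<open>t\<close>, and
  \<open>code [] = 0\<close> is a dummy value.\<close>

fun code :: "nat list \<Rightarrow> nat" where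
  "code [] = 0"
| "code [v] = init"
| "code (v # u # P) = nxt (code (u # P)) v"

text \<open>A shortest optimal path has cost and number of vertices at most \<open>n\<close>, so the
  part of its code above the window is at most \<open>n * n + (n - 1)\<close>, below
  \<open>n * (n + 1)\<close>.\<close>

definition Q :: nat where "Q = n * (n + 1) * N"

lemma n_pos: "0 < n" using s_less by simp

lemma N_pos: "0 < N" using n_pos by (simp add: N_def)

lemma rep_less: "rep i < n ^ i"
proof (induction i)
  case (Suc i)
  have "rep (Suc i) < rep i * n + n" using t_less by simp
  also have "\<dots> = Suc (rep i) * n" by simp
  also have "\<dots> \<le> n ^ i * n" using Suc by (intro mult_right_mono) simp_all
  finally show ?case by (simp add: mult.commute)
qed simp

lemma dig_0 [simp]: "dig q 0 = q mod n"
  by (simp add: dig_def)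

lemma dig_less: "dig q i < n"
  using n_pos by (simp add: dig_def)

lemma dig_shift: "v < n \<Longrightarrow> dig (q * n + v) (Suc i) = dig q i"
  by (simp add: dig_def div_mult2_eq)

lemma dig_high:
  assumes "i < K"
  shows "dig (a * N + b) i = dig b i"
proof -
  have "N = n ^ i * (n * n ^ (K - Suc i))"
    using assms unfolding N_def by (metis add_Suc_right add_Suc_shift le_add_diff_inverse less_eq_Suc_le power_Suc power_add)
  then have "a * N + b = b + n ^ i * (n * (a * n ^ (K - Suc i)))"
    by (simp add: mult_ac)
  then have "(a * N + b) div n ^ i = b div n ^ i + n * (a * n ^ (K - Suc i))"
    using n_pos by (simp only:) simp
  then show ?thesis by (simp add: dig_def)
qed

lemma dig_mod:
  assumes "i < K"
  shows "dig (b mod N) i = dig b i"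
  using dig_high[OF assms, of "b div N" "b mod N"] by (simp only: div_mult_mod_eq)

lemma dig_rep: "i < j \<Longrightarrow> dig (rep j) i = t"
proof (induction j arbitrary: i)
  case (Suc j)
  then show ?case
    using t_less by (cases i) (simp_all add: dig_shift)
qed simp

lemma K_pos: "0 < K" by (simp add: K_def)

lemma dig_nxt:
  assumes "v < n" "i < K"
  shows "dig (nxt q v) i = (case i of 0 \<Rightarrow> v | Suc j \<Rightarrow> dig q j)"
  using assms by (cases i) (simp_all only: nxt_def dig_high dig_mod, simp_all add: dig_shift)

lemma nxt_div: "nxt q v div N = q div N + n * w q v + 1"
  unfolding nxt_def using N_pos by (subst div_mult_self3) simp_all

lemma nxt_less: "q < nxt q v"
proof -
  have "q = q div N * N + q mod N" by (simp only: div_mult_mod_eq)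
  also have "\<dots> < q div N * N + N" using N_pos by simp
  also have "\<dots> \<le> nxt q v" by (simp add: nxt_def algebra_simps)
  finally show ?thesis .
qed

text \<open>Repetitions are allowed, since the last \<open>K\<close> vertices do not tell whether a
  new vertex occurred earlier.\<close>

definition walk :: "nat list \<Rightarrow> bool" where
  "walk P \<longleftrightarrow> P \<noteq> [] \<and> last P = t \<and> set P \<subseteq> {..<n} \<and> successively E P"

lemma walk_Cons: "P \<noteq> [] \<Longrightarrow> walk (v # P) \<longleftrightarrow> v < n \<and> E v (hd P) \<and> walk P"
  by (auto simp: walk_def successively_Cons)

lemma w_window:
  assumes "walk P" and "\<forall>i<K. dig q i = (if i < length P then P ! i else t)"
  shows "w q v = card (Nb v - NS (set (take K P)))"
proof -
  have "(\<lambda>i. dig q i) ` {..<K} = set (take K P)"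
  proof (intro equalityI subsetI)
    fix y assume "y \<in> dig q ` {..<K}"
    then obtain i where i: "i < K" "y = (if i < length P then P ! i else t)"
      using assms(2) by auto
    show "y \<in> set (take K P)"
    proof (cases "i < length P")
      case True
      with i show ?thesis by (auto simp: in_set_conv_nth intro!: exI[of _ i])
    next
      case False
      \<comment> \<open>Padding is harmless: padded digits are \<open>t\<close>, the last vertex of
        the walk, and a walk shorter than \<open>K\<close> lies entirely inside its window.\<close>
      with i have "take K P = P" "y = last P" using assms(1) by (auto simp: walk_def)
      with assms(1) show ?thesis unfolding walk_def by (metis last_in_set)
    qed
  next
    fix y assume "y \<in> set (take K P)"
    then obtain i where "i < K" "i < length P" "y = P ! i"
      by (auto simp: in_set_conv_nth)
    with assms(2) show "y \<in> dig q ` {..<K}" by (auto intro!: image_eqI[of _ _ i])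
  qed
  then have "(\<Union>i<K. Nb (dig q i)) = NS (set (take K P))"
    unfolding closed_nbh_set_def by (metis image_image)
  then show ?thesis by (simp add: w_def)
qed

text \<open>Both halves share one induction, since the charge added to the quotient is right only if
  the digits form the true window. The initial state contributes no length, hence
  \<open>length P - 1\<close>.\<close>

lemma code_walk:
  assumes "walk P"
  shows "(\<forall>i<K. dig (code P) i = (if i < length P then P ! i else t)) \<and>
    code P div N = n * window_cost P + (length P - 1)"
  using assms
proof (induction P rule: code.induct)
  case 1
  then show ?case by (simp add: walk_def)
next
  case (2 v)
  then have v: "v = t" by (simp add: walk_def)
  have "dig init i = t" if "i < K" for i
    using that by (simp add: init_def dig_high dig_rep)
  moreover have "init div N = n * card (Nb t)"
    using rep_less[of K] N_pos by (simp add: init_def N_def)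
  ultimately show ?case using v by auto
next
  case (3 v u P)
  then have wk: "walk (u # P)" and v: "v < n"
    by (simp_all add: walk_Cons)
  note IH = 3(1)[OF wk]
  have "w (code (u # P)) v = card (Nb v - NS (set (take K (u # P))))"
    using w_window[OF wk] IH by blast
  then have "code (v # u # P) div N = n * window_cost (v # u # P) + (length (v # u # P) - 1)"
    using IH by (simp add: nxt_div algebra_simps)
  moreover have "dig (code (v # u # P)) i = (if i < length (v # u # P) then (v # u # P) ! i else t)"
    if "i < K" for i
  proof -
    have "dig (code (v # u # P)) i = (case i of 0 \<Rightarrow> v | Suc j \<Rightarrow> dig (code (u # P)) j)"
      using dig_nxt[OF v that] by simp
    then show ?thesis using that IH by (cases i) simp_all
  qed
  ultimately show ?case by blast
qed

lemma code_mod: "walk P \<Longrightarrow> code P mod n = hd P"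
  using code_walk[of P] K_pos by (auto simp: walk_def hd_conv_nth dest!: spec[of _ 0])

section \<open>Predecessor tables\<close>

definition pred_ok :: "(nat \<Rightarrow> nat) \<Rightarrow> nat \<Rightarrow> nat \<Rightarrow> bool" where
  "pred_ok T q' q \<longleftrightarrow> T q' \<noteq> 0 \<and> E (q mod n) (q' mod n) \<and> q = nxt q' (q mod n)"

text \<open>Entry 0 means unreachable; otherwise an entry is one more than a predecessor, so that
  predecessor 0 can be stored too. At \<open>init\<close>, where chains end, the entry is merely
  nonzero.\<close>

definition is_table :: "(nat \<Rightarrow> nat) \<Rightarrow> bool" where
  "is_table T \<longleftrightarrow> (\<forall>q<Q. (q = init \<longrightarrow> T q \<noteq> 0) \<and>
     (q \<noteq> init \<and> T q \<noteq> 0 \<longrightarrow> T q - 1 < q \<and> pred_ok T (T q - 1) q) \<and>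
     (\<forall>q'<q. pred_ok T q' q \<longrightarrow> T q \<noteq> 0))"

text \<open>Predecessors are smaller, so the chain from \<open>q\<close> descends to
  \<open>init\<close>; read upwards it builds one walk, of whose suffixes its members are the
  codes.\<close>

lemma table_sound:
  assumes T: "is_table T" and "q < Q" "T q \<noteq> 0"
  shows "\<exists>P. walk P \<and> (\<forall>j<length P. ((\<lambda>x. T x - 1) ^^ j) q = code (drop j P))"
  using assms(2,3)
proof (induction q rule: less_induct)
  case (less q)
  show ?case
  proof (cases "q = init")
    case True
    then have "walk [t] \<and> (\<forall>j<length [t]. ((\<lambda>x. T x - 1) ^^ j) q = code (drop j [t]))"
      using t_less by (simp add: walk_def)
    then show ?thesis by blast
  next
    case False
    let ?q' = "T q - 1"
    have q': "?q' < q" "pred_ok T ?q' q"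
      using T less.prems False unfolding is_table_def by blast+
    then have "\<exists>P. walk P \<and> (\<forall>j<length P. ((\<lambda>x. T x - 1) ^^ j) ?q' = code (drop j P))"
      using less.prems by (intro less.IH) (auto simp: pred_ok_def)
    then obtain P where P: "walk P"
      "\<And>j. j < length P \<Longrightarrow> ((\<lambda>x. T x - 1) ^^ j) ?q' = code (drop j P)"
      by blast
    have ne: "P \<noteq> []" using P(1) by (simp add: walk_def)
    have c: "?q' = code P" using P(2)[of 0] ne by simp
    then have "hd P = ?q' mod n" using code_mod[OF P(1)] by simp
    then have wk: "walk (q mod n # P)"
      using q'(2) P(1) ne n_pos by (simp add: walk_Cons pred_ok_def)
    have cq: "code (q mod n # P) = q"
      using q'(2) c ne by (cases P) (auto simp: pred_ok_def)
    have "((\<lambda>x. T x - 1) ^^ j) q = code (drop j (q mod n # P))" if "j < length (q mod n # P)" for j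
      using that cq P(2) by (cases j) (simp_all add: funpow_Suc_right del: funpow.simps(2))
    with wk show ?thesis by blast
  qed
qed

lemma table_complete:
  assumes T: "is_table T"
  shows "walk P \<Longrightarrow> code P < Q \<Longrightarrow> T (code P) \<noteq> 0"
proof (induction P rule: code.induct)
  case (2 v)
  then show ?case using T by (simp add: is_table_def)
next
  case (3 v u P)
  let ?q = "code (u # P)"
  have wk: "walk (u # P)" and v: "v < n" and e: "E v u"
    using 3(2) by (simp_all add: walk_Cons)
  have lt: "?q < code (v # u # P)" by (simp add: nxt_less)
  with 3 wk have "T ?q \<noteq> 0" by simp
  moreover have "code (v # u # P) mod n = v" using code_mod[OF 3(2)] by simp
  moreover have "?q mod n = u" using code_mod[OF wk] by simp
  ultimately have "pred_ok T ?q (code (v # u # P))"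
    using e by (simp add: pred_ok_def)
  with lt T 3(3) show ?case unfolding is_table_def by blast
qed (simp add: walk_def)

lemma is_path_walk: "is_path n E s t P \<longleftrightarrow> walk P \<and> hd P = s \<and> distinct P"
  by (auto simp: is_path_iff walk_def)

lemma code_shortest_optimal:
  assumes so: "shortest_optimal P"
  shows "code P div N < n * path_cost n E P + n" "code P < Q"
    "code P div N = n * path_cost n E P + (length P - 1)"
proof -
  have P: "is_path n E s t P"
    using so by (simp add: shortest_optimal_def optimal_secluded_path_def)
  then have sub: "set P \<subseteq> {..<n}" by (simp add: is_path_iff)
  have "length P \<le> n"
    using card_mono[OF _ sub] P by (simp add: is_path_iff distinct_card)
  moreover show eq: "code P div N = n * path_cost n E P + (length P - 1)"
    using code_walk P window_cost_shortest_optimal[OF so] by (simp add: is_path_walk)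
  ultimately show less: "code P div N < n * path_cost n E P + n"
    using n_pos by simp
  have "path_cost n E P \<le> n"
    using card_mono[OF _ NS_subset[OF sub]] by (simp add: path_cost_def)
  then have "n * path_cost n E P + n \<le> n * (n + 1)" by simp
  with less have "code P div N < n * (n + 1)" by linarith
  then show "code P < Q"
    using N_pos by (simp add: Q_def div_less_iff_less_mult)
qed

lemma table_no_path:
  assumes T: "is_table T" and none: "\<nexists>P. is_path n E s t P" and q: "q < Q" "T q \<noteq> 0"
  shows "q mod n \<noteq> s"
proof
  assume s: "q mod n = s"
  obtain P where P: "walk P" "\<And>j. j < length P \<Longrightarrow> ((\<lambda>x. T x - 1) ^^ j) q = code (drop j P)"
    using table_sound[OF T q] by blast
  then have "code P = q" using P(2)[of 0] by (simp add: walk_def)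
  then have "hd P = s" using code_mod[OF P(1)] s by simp
  then have "(s, t) \<in> (adj_on (set P))\<^sup>*"
    using P(1) walk_rtrancl[of P "set P"] by (auto simp: walk_def)
  moreover have "s \<in> set P" using \<open>hd P = s\<close> P(1) by (auto simp: walk_def)
  ultimately show False using rtrancl_path[of s t "set P"] s_less none by blast
qed

text \<open>The walk \<open>W\<close> behind \<open>q\<close> contains a path from \<open>s\<close>
  to \<open>t\<close>, so its cost is at least the optimum, and by minimality of \<open>q\<close>
  its window cost is at most the optimum. Equality makes the lengths comparable, and
  \<open>W\<close> has at most \<open>length P\<close> entries but at least that many distinct
  vertices, so it is a path. The premise on \<open>q\<close> is conditional because a failed search
  returns \<open>Q\<close>.\<close>

lemma table_path:
  assumes T: "is_table T" and ex: "is_path n E s t P0"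
    and q: "q < Q \<Longrightarrow> T q \<noteq> 0 \<and> q mod n = s"
    and least: "\<And>q'. q' < Q \<Longrightarrow> T q' \<noteq> 0 \<Longrightarrow> q' mod n = s \<Longrightarrow> q \<le> q'"
  shows "q < Q"
    and "optimal_secluded_path n E s t
           (map (\<lambda>j. ((\<lambda>x. T x - 1) ^^ j) q mod n) [0..<Suc (q div N mod n)])"
    and "q div N mod n < n"
proof -
  obtain P where so: "shortest_optimal P" using ex_shortest_optimal[OF ex] by blast
  then have P: "is_path n E s t P"
    by (simp add: shortest_optimal_def optimal_secluded_path_def)
  have le: "q \<le> code P"
    using least[of "code P"] code_shortest_optimal(2)[OF so] table_complete[OF T, of P]
      code_mod[of P] P by (simp add: is_path_walk)
  then show qQ: "q < Q" using code_shortest_optimal(2)[OF so] by simp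
  then have q: "T q \<noteq> 0" "q mod n = s" using q by simp_all
  obtain W where W: "walk W" "\<And>j. j < length W \<Longrightarrow> ((\<lambda>x. T x - 1) ^^ j) q = code (drop j W)"
    using table_sound[OF T qQ q(1)] by blast
  have cW: "code W = q" using W(2)[of 0] W(1) by (simp add: walk_def)
  have hdW: "hd W = s" using code_mod[OF W(1)] cW q(2) by simp
  have "code W div N \<le> code P div N" using le cW by (simp add: div_le_mono)
  then have le2: "n * window_cost W + (length W - 1) \<le> n * path_cost n E P + (length P - 1)"
    using code_walk[OF W(1)] code_shortest_optimal(3)[OF so] by simp
  \<comment> \<open>The length term of \<open>P\<close> is below \<open>n\<close>, so it cannot hide
    a difference in cost.\<close>
  also have "\<dots> < n * path_cost n E P + n"
    using code_shortest_optimal(1,3)[OF so] by simp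
  finally have "n * window_cost W < n * (path_cost n E P + 1)" by simp
  then have "window_cost W < path_cost n E P + 1" by (simp only: nat_mult_less_cancel1[OF n_pos])
  then have dpW: "window_cost W \<le> path_cost n E P" by simp
  have costW: "card (NS (set W)) \<le> path_cost n E P" using window_cost_ge[of W] dpW by simp
  have conn: "(s, t) \<in> (adj_on (set W))\<^sup>*"
    using W(1) walk_rtrancl[of W "set W"] hdW by (auto simp: walk_def)
  have sW: "s \<in> set W" using hdW W(1) by (auto simp: walk_def)
  have cardW: "length P \<le> card (set W)"
    using shortcut[OF so _ sW conn] costW by (meson List.finite_set not_less)
  obtain R where R: "is_path n E s t R" "set R \<subseteq> set W"
    using rtrancl_path[OF conn sW s_less] by blast
  have "path_cost n E P \<le> path_cost n E R"
    using so R(1) by (simp add: shortest_optimal_def optimal_secluded_path_def)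
  also have "\<dots> \<le> card (NS (set W))"
    unfolding path_cost_def by (intro card_mono NS_mono finite_NS R) simp
  finally have "window_cost W = path_cost n E P" using window_cost_ge[of W] dpW by simp
  with le2 have "length W - 1 \<le> length P - 1" by simp
  moreover have "P \<noteq> []" "W \<noteq> []" using P W(1) by (simp_all add: is_path_iff walk_def)
  ultimately have "length W \<le> length P" by (cases P; cases W) auto
  with cardW have "distinct W"
    using card_length[of W] by (intro card_distinct) simp
  then have pathW: "is_path n E s t W" using W(1) hdW by (simp add: is_path_walk)
  moreover have "path_cost n E W \<le> path_cost n E P" using costW by (simp add: path_cost_def)
  ultimately have opt: "optimal_secluded_path n E s t W"
    using so unfolding shortest_optimal_def optimal_secluded_path_def by (meson order_trans)
  have "length W \<le> n"
    using card_mono[of "{..<n}" "set W"] pathW by (simp add: is_path_iff distinct_card)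
  \<comment> \<open>The cost is multiplied by \<open>n\<close> and vanishes modulo \<open>n\<close>,
    while \<open>length W - 1\<close> is below \<open>n\<close>.\<close>
  then have lenW: "Suc (q div N mod n) = length W"
    using code_walk[OF W(1)] cW \<open>W \<noteq> []\<close> by (cases W) auto
  have "((\<lambda>x. T x - 1) ^^ j) q mod n = W ! j" if "j < length W" for j
  proof -
    have "walk (drop j W)"
      using W(1) that unfolding walk_def
      by (auto dest: in_set_dropD) (metis append_take_drop_id successively_append_iff)
    then show ?thesis
      using W(2)[OF that] code_mod[of "drop j W"] that by (simp add: hd_drop_conv_nth)
  qed
  then have "map (\<lambda>j. ((\<lambda>x. T x - 1) ^^ j) q mod n) [0..<length W] = W"
    by (intro nth_equalityI) auto
  with opt lenW show "optimal_secluded_path n E s t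
      (map (\<lambda>j. ((\<lambda>x. T x - 1) ^^ j) q mod n) [0..<Suc (q div N mod n)])"
    by simp
  show "q div N mod n < n" using n_pos by simp
qed

end


section \<open>Array-filling loops and polynomial time\<close>

definition bnd :: "nat \<Rightarrow> (nat \<Rightarrow> nat) \<Rightarrow> bool" where
  "bnd M m \<longleftrightarrow> (\<forall>a. vis a \<longrightarrow> m a \<le> M)"

lemma le_power_self: "2 \<le> M \<Longrightarrow> c \<le> (M::nat) ^ c"
  by (metis less_exp less_imp_le_nat order_trans power_mono zero_le)

lemma add_le_power:
  assumes "2 \<le> (M::nat)" "x \<le> M ^ i" "y \<le> M ^ j"
  shows "x + y \<le> M ^ Suc (i + j)"
proof -
  have "1 \<le> M ^ i" "1 \<le> M ^ j" using assms(1) by simp_all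
  then have "M ^ i * 1 \<le> M ^ i * M ^ j" "1 * M ^ j \<le> M ^ i * M ^ j"
    by (intro mult_mono; simp)+
  then have "x + y \<le> 2 * (M ^ i * M ^ j)" using assms(2,3) by linarith
  also have "\<dots> \<le> M * (M ^ i * M ^ j)" using assms(1) by (rule mult_right_mono) simp
  finally show ?thesis by (simp add: power_add)
qed

lemma mult_le_power:
  assumes "x \<le> M ^ i" "y \<le> (M::nat) ^ j"
  shows "x * y \<le> M ^ (i + j)"
  unfolding power_add using assms by (rule mult_mono) simp_all

text \<open>Powers of one number \<open>M \<ge> 2\<close> stand in for polynomials:
  \<open>c \<le> M ^ c\<close> absorbs constants, and sums and products of powers stay below powers.
  The exponents are chosen before the memory, so they depend on the expression alone.\<close>

lemma ev_tm_poly: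
  "wf_exp e \<Longrightarrow> \<exists>k l. \<forall>m M. 2 \<le> M \<longrightarrow> bnd M m \<longrightarrow> ev e m \<le> M ^ k \<and> tm e m \<le> M ^ l"
proof (induction e)
  case (Num c)
  show ?case
    by (rule exI[of _ c], rule exI[of _ 1]) (use le_power_self in auto)
next
  case (Var x)
  then show ?case
    by (intro exI[of _ 1]) (auto simp: bnd_def vis_def)
next
  case (Arr e)
  then obtain k l where kl: "\<And>m M. 2 \<le> M \<Longrightarrow> bnd M m \<Longrightarrow> ev e m \<le> M ^ k \<and> tm e m \<le> M ^ l"
    by auto
  have "ev (Arr e) m \<le> M ^ 1 \<and> tm (Arr e) m \<le> M ^ Suc (l + 3)"
    if "2 \<le> M" "bnd M m" for m M
    using add_le_power[OF that(1) conjunct2[OF kl[OF that]] le_power_self[OF that(1), of 3]] that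
    by (simp add: bnd_def vis_def)
  then show ?case by blast
next
  case (Plus a b)
  then obtain k l k' l' where
    kl: "\<And>m M. 2 \<le> M \<Longrightarrow> bnd M m \<Longrightarrow> ev a m \<le> M ^ k \<and> tm a m \<le> M ^ l" and
    kl': "\<And>m M. 2 \<le> M \<Longrightarrow> bnd M m \<Longrightarrow> ev b m \<le> M ^ k' \<and> tm b m \<le> M ^ l'"
    by (metis wf_exp.simps(4))
  have "ev (Plus a b) m \<le> M ^ Suc (k + k') \<and> tm (Plus a b) m \<le> M ^ Suc (Suc (l + l') + 1)"
    if M: "2 \<le> M" "bnd M m" for m M
    unfolding ev.simps tm.simps using kl[OF M] kl'[OF M]
    by (intro conjI add_le_power M(1) le_power_self) blast+
  then show ?case by blast
next
  case (Minus a b)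
  then obtain k l k' l' where
    kl: "\<And>m M. 2 \<le> M \<Longrightarrow> bnd M m \<Longrightarrow> ev a m \<le> M ^ k \<and> tm a m \<le> M ^ l" and
    kl': "\<And>m M. 2 \<le> M \<Longrightarrow> bnd M m \<Longrightarrow> ev b m \<le> M ^ k' \<and> tm b m \<le> M ^ l'"
    by (metis wf_exp.simps(5))
  have "ev (Minus a b) m \<le> M ^ k \<and> tm (Minus a b) m \<le> M ^ Suc (Suc (l + l') + 1)"
    if M: "2 \<le> M" "bnd M m" for m M
    unfolding ev.simps tm.simps using kl[OF M] kl'[OF M]
    by (intro conjI add_le_power M(1) le_power_self le_trans[OF diff_le_self]) blast+
  then show ?case by blast
next
  case (Sum x b e)
  then obtain k l k' l' where
    kl: "\<And>m M. 2 \<le> M \<Longrightarrow> bnd M m \<Longrightarrow> ev b m \<le> M ^ k \<and> tm b m \<le> M ^ l" and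
    kl': "\<And>m M. 2 \<le> M \<Longrightarrow> bnd M m \<Longrightarrow> ev e m \<le> M ^ k' \<and> tm e m \<le> M ^ l'"
    by (metis wf_exp.simps(6))
  have "ev (Sum x b e) m \<le> M ^ (k + Suc k * k') \<and>
      tm (Sum x b e) m \<le> M ^ Suc (Suc (l + (k + Suc (Suc k * l' + 7))) + 9)"
    if M: "2 \<le> M" "bnd M m" for m M
  proof -
    have b: "ev b m \<le> M ^ k" "tm b m \<le> M ^ l" using kl[OF M] by auto
    \<comment> \<open>The summation variable can exceed \<open>M\<close>, but not
      \<open>M ^ k\<close>. The hypothesis for the body is therefore used with
      \<open>M ^ Suc k\<close> as memory bound, which multiplies its exponents.\<close>
    have e: "ev e (m(x := i)) \<le> M ^ (Suc k * k') \<and> tm e (m(x := i)) \<le> M ^ (Suc k * l')"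
      if "i < ev b m" for i
    proof -
      have k1: "M ^ k \<le> M ^ Suc k" "M ^ 1 \<le> M ^ Suc k"
        using M by (intro power_increasing; simp)+
      have "2 \<le> M ^ Suc k" using M(1) k1(2) by (simp del: power_Suc)
      moreover have "bnd (M ^ Suc k) (m(x := i))"
        using M(2) k1 that b unfolding bnd_def
        by (auto simp del: power_Suc intro: le_trans)
      ultimately show ?thesis using kl' by (metis power_mult)
    qed
    have "(\<Sum>i<ev b m. ev e (m(x := i))) \<le> ev b m * M ^ (Suc k * k')"
      using sum_bounded_above[of "{..<ev b m}" "\<lambda>i. ev e (m(x := i))" "M ^ (Suc k * k')"] e by simp
    also have "\<dots> \<le> M ^ (k + Suc k * k')"
      by (rule mult_le_power[OF b(1)]) simp
    finally have 1: "ev (Sum x b e) m \<le> M ^ (k + Suc k * k')" by simp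
    have "tm e (m(x := i)) + 7 \<le> M ^ Suc (Suc k * l' + 7)" if "i < ev b m" for i
      by (rule add_le_power[OF M(1) _ le_power_self[OF M(1)]]) (use e[OF that] in blast)
    then have "(\<Sum>i<ev b m. tm e (m(x := i)) + 7) \<le> ev b m * M ^ Suc (Suc k * l' + 7)"
      using sum_bounded_above[of "{..<ev b m}" "\<lambda>i. tm e (m(x := i)) + 7"
          "M ^ Suc (Suc k * l' + 7)"] by simp
    also have "\<dots> \<le> M ^ (k + Suc (Suc k * l' + 7))"
      by (rule mult_le_power[OF b(1)]) simp
    finally have "tm b m + (\<Sum>i<ev b m. tm e (m(x := i)) + 7) + 9
        \<le> M ^ Suc (Suc (l + (k + Suc (Suc k * l' + 7))) + 9)"
      by (intro add_le_power M(1) b(2) le_power_self)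
    moreover have "tm (Sum x b e) m = tm b m + (\<Sum>i<ev b m. tm e (m(x := i)) + 7) + 9"
      by simp
    ultimately show ?thesis using 1 by simp
  qed
  then show ?case by blast
qed

lemma tm_poly:
  assumes "wf_exp e"
  obtains l where "\<And>m M. 2 \<le> M \<Longrightarrow> bnd M m \<Longrightarrow> tm e m \<le> M ^ l"
  using ev_tm_poly[OF assms] by blast

section \<open>Loops that fill an array\<close>

text \<open>Reference semantics of the loop, blind to scratch registers. Each entry is evaluated in
  the memory reached so far, so it may depend on earlier entries, as dynamic programming
  requires.\<close>

fun fill_mem :: "nat \<Rightarrow> exp \<Rightarrow> exp \<Rightarrow> (nat \<Rightarrow> nat) \<Rightarrow> nat \<Rightarrow> (nat \<Rightarrow> nat)" where
  "fill_mem x a e m 0 = m(x := 0)"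
| "fill_mem x a e m (Suc i) = (let m1 = fill_mem x a e m i in
     m1(mem_base + (ev a m1 + i) := ev e m1, x := Suc i))"

definition fill_len :: "exp \<Rightarrow> exp \<Rightarrow> exp \<Rightarrow> nat" where
  "fill_len b a e = len b + len a + len e + 13"

definition fill_comp :: "nat \<Rightarrow> exp \<Rightarrow> exp \<Rightarrow> exp \<Rightarrow> nat \<Rightarrow> instr list" where
  "fill_comp x b a e pc = (let k = nvars; l = pc + len b + 1 in
     compile b k pc @ [Const x 0] @ [Jz k (pc + fill_len b a e)] @
     compile (Plus a (Var x)) (k + 1) (l + 1) @
     compile e (k + 2) (l + 1 + len (Plus a (Var x))) @
     [Const (k + 3) mem_base, Add (k + 1) (k + 1) (k + 3), Store (k + 1) (k + 2),
      Const (k + 3) 1, Add x x (k + 3), Sub k k (k + 3), Const (k + 3) 0] @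
     [Jz (k + 3) l])"

lemma length_fill_comp [simp]: "length (fill_comp x b a e pc) = fill_len b a e"
  by (simp add: fill_comp_def fill_len_def)

lemma fill_mem_var: "x < nvars \<Longrightarrow> fill_mem x a e m i x = i"
  by (cases i) (simp_all add: Let_def)

lemma nvars_mem_base: "nvars + 5 < mem_base"
  by (simp add: nvars_def mem_base_def)

lemma fill_correct:
  assumes wf: "wf_exp b" "wf_exp a" "wf_exp e" "x < nvars"
    and fits: "fits b nvars" "fits a (nvars + 1)" "fits e (nvars + 2)"
    and code: "code_at p pc (fill_comp x b a e pc)"
  shows "\<exists>m'. steps p (tm b m + 1 +
      (\<Sum>i<ev b m. tm (Plus a (Var x)) (fill_mem x a e m i) + tm e (fill_mem x a e m i) + 9) + 1)
      (pc, m) (pc + fill_len b a e, m') \<and>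
    (\<forall>v. vis v \<longrightarrow> m' v = fill_mem x a e m (ev b m) v)"
proof -
  define k where "k = nvars"
  define l where "l = pc + len b + 1"
  define aa where "aa = Plus a (Var x)"
  let ?G = "fill_mem x a e m"
  let ?c = "[Const (k + 3) mem_base, Add (k + 1) (k + 1) (k + 3), Store (k + 1) (k + 2),
      Const (k + 3) 1, Add x x (k + 3), Sub k k (k + 3), Const (k + 3) 0]"
  have xk: "x < k" and kb: "k + 5 < mem_base"
    using wf(4) nvars_mem_base by (simp_all add: k_def)
  have lens: "length ?c = 7" "length [Const x 0] = 1" "length [Jz k z] = 1" for z by simp_all
  have c: "code_at p pc (compile b k pc)" "code_at p (pc + len b) [Const x 0]"
    "code_at p l [Jz k (pc + fill_len b a e)]"
    "code_at p (l + 1) (compile aa (k + 1) (l + 1))"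
    "code_at p (l + 1 + len aa) (compile e (k + 2) (l + 1 + len aa))"
    "code_at p (l + 1 + len aa + len e) ?c"
    "code_at p (l + 1 + len aa + len e + 7) [Jz (k + 3) l]"
    using code
    unfolding fill_comp_def Let_def code_at_append length_compile k_def[symmetric] lens
      l_def[symmetric] aa_def[symmetric] by blast+
  have pe: "l + 1 + len aa + len e + 7 + 1 = pc + fill_len b a e"
    by (simp add: l_def aa_def fill_len_def)
  have "nvars \<le> k" "fits b k" using fits by (simp_all add: k_def)
  from compile_correct[OF wf(1) this c(1), of m] obtain m1 where m1:
    "steps p (tm b m) (pc, m) (pc + len b, m1)" "m1 k = ev b m"
    "\<And>v. v < k \<or> mem_base \<le> v \<Longrightarrow> m1 v = m v" by blast
  define mi where "mi = m1(x := 0)"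
  have s1: "steps p 1 (pc + len b, m1) (l, mi)"
    using steps_straight[OF c(2), of 1 m1] by (simp add: mi_def l_def)
  have mi: "mi k = ev b m" "\<And>v. vis v \<Longrightarrow> mi v = ?G 0 v"
    using m1 xk kb by (auto simp: mi_def vis_def k_def)
  have loop: "\<exists>m3. steps p ((\<Sum>j=i..<i+r. tm aa (?G j) + tm e (?G j) + 9) + 1) (l, m2)
      (pc + fill_len b a e, m3) \<and> (\<forall>v. vis v \<longrightarrow> m3 v = ?G (i + r) v)"
    if "m2 k = r" "\<And>v. vis v \<Longrightarrow> m2 v = ?G i v" for r i m2
    using that
  proof (induction r arbitrary: i m2)
    case 0
    have "steps p 1 (l, m2) (pc + fill_len b a e, m2)"
      using c(3) 0 by simp
    then show ?case using 0(2) by (intro exI[of _ m2]) simp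
  next
    case (Suc r)
    have s1: "steps p 1 (l, m2) (l + 1, m2)"
      using c(3) Suc.prems(1) by simp
    have waa: "wf_exp aa" "nvars \<le> k + 1" "fits aa (k + 1)"
      using wf fits kb by (simp_all add: aa_def k_def)
    from compile_correct[OF waa c(4), of m2] obtain m3 where m3:
      "steps p (tm aa m2) (l + 1, m2) (l + 1 + len aa, m3)" "m3 (k + 1) = ev aa m2"
      "\<And>v. v < k + 1 \<or> mem_base \<le> v \<Longrightarrow> m3 v = m2 v" by blast
    have we: "nvars \<le> k + 2" "fits e (k + 2)" using fits by (simp_all add: k_def)
    from compile_correct[OF wf(3) we c(5), of m3] obtain m4 where m4:
      "steps p (tm e m3) (l + 1 + len aa, m3) (l + 1 + len aa + len e, m4)"
      "m4 (k + 2) = ev e m3" "\<And>v. v < k + 2 \<or> mem_base \<le> v \<Longrightarrow> m4 v = m3 v" by blast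
    have vis3: "\<forall>v. vis v \<longrightarrow> m2 v = ?G i v" "\<forall>v. vis v \<longrightarrow> m3 v = ?G i v"
      "\<forall>v. vis v \<longrightarrow> m4 v = ?G i v"
      using Suc.prems(2) m3(3) m4(3) by (auto simp: vis_def k_def)
    have eqs: "tm aa m2 = tm aa (?G i)" "ev aa m2 = ev a (?G i) + i"
      "tm e m3 = tm e (?G i)" "ev e m3 = ev e (?G i)"
      using tm_cong[OF waa(1) vis3(1)] ev_cong[OF waa(1) vis3(1)]
        tm_cong[OF wf(3) vis3(2)] ev_cong[OF wf(3) vis3(2)] fill_mem_var[OF wf(4)]
      by (simp_all add: aa_def)
    define m5 where "m5 = exec_list ?c m4"
    have s5: "steps p 7 (l + 1 + len aa + len e, m4) (l + 1 + len aa + len e + 7, m5)"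
      using steps_straight[OF c(6), of 7 m4] by (simp add: m5_def)
    have m4k: "m4 (k + 1) = ev a (?G i) + i" "m4 (k + 2) = ev e (?G i)" "m4 k = Suc r" "m4 x = i"
      using m4 m3 eqs Suc.prems(1) vis3 wf(4) xk fill_mem_var[OF wf(4)]
      by (auto simp: vis_def)
    have m5: "m5 = m4(mem_base + (ev a (?G i) + i) := ev e (?G i), x := Suc i, k := r,
        k + 1 := mem_base + (ev a (?G i) + i), k + 3 := 0)"
      unfolding m5_def using m4k xk kb by (auto simp: fun_eq_iff add.commute)
    have s6: "steps p 1 (l + 1 + len aa + len e + 7, m5) (l, m5)"
      using c(7) m5 by simp
    have "m5 k = r" using xk kb by (simp add: m5)
    moreover have "m5 v = ?G (Suc i) v" if "vis v" for v
      using vis3(3) that xk kb by (auto simp: m5 Let_def vis_def k_def)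
    ultimately obtain m6 where m6:
      "steps p ((\<Sum>j=Suc i..<Suc i+r. tm aa (?G j) + tm e (?G j) + 9) + 1) (l, m5)
        (pc + fill_len b a e, m6)"
      "\<forall>v. vis v \<longrightarrow> m6 v = ?G (Suc i + r) v"
      using Suc.IH[of m5 "Suc i"] by blast
    have split: "(\<Sum>j=i..<i+Suc r. f j) = f i + (\<Sum>j=Suc i..<Suc i+r. f j)"
      for f :: "nat \<Rightarrow> nat"
      by (simp add: sum.atLeast_Suc_lessThan)
    have time: "1 + tm aa m2 + tm e m3 + 7 + 1 +
        ((\<Sum>j=Suc i..<Suc i+r. tm aa (?G j) + tm e (?G j) + 9) + 1) =
        (\<Sum>j=i..<i+Suc r. tm aa (?G j) + tm e (?G j) + 9) + 1"
      unfolding split eqs by simp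
    have "steps p ((\<Sum>j=i..<i+Suc r. tm aa (?G j) + tm e (?G j) + 9) + 1) (l, m2)
        (pc + fill_len b a e, m6)"
      using steps_trans[OF steps_trans[OF steps_trans[OF steps_trans[OF steps_trans[OF
              s1 m3(1)] m4(1)] s5] s6] m6(1)]
      unfolding time .
    with m6(2) show ?case by (intro exI[of _ m6]) simp
  qed
  from loop[OF mi] obtain m3 where m3:
    "steps p ((\<Sum>j<ev b m. tm aa (?G j) + tm e (?G j) + 9) + 1) (l, mi)
      (pc + fill_len b a e, m3)" "\<forall>v. vis v \<longrightarrow> m3 v = ?G (ev b m) v"
    unfolding add_0 atLeast0LessThan by blast
  with steps_trans[OF steps_trans[OF m1(1) s1] m3(1)] show ?thesis
    by (auto simp: aa_def add.assoc)
qed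

text \<open>Isolates an exponent that is uniform in program, memory and bound, so that it can be
  fixed before any graph is given.\<close>

definition fill_time :: "nat \<Rightarrow> exp \<Rightarrow> exp \<Rightarrow> exp \<Rightarrow> nat \<Rightarrow> bool" where
  "fill_time x b a e k \<longleftrightarrow> (\<forall>p pc m M. code_at p pc (fill_comp x b a e pc) \<longrightarrow> 2 \<le> M \<longrightarrow> bnd M m \<longrightarrow>
     ev b m \<le> M \<longrightarrow> (\<forall>i<ev b m. bnd M (fill_mem x a e m i)) \<longrightarrow>
     (\<exists>m' T. T \<le> M ^ k \<and> steps p T (pc, m) (pc + fill_len b a e, m') \<and>
       (\<forall>v. vis v \<longrightarrow> m' v = fill_mem x a e m (ev b m) v)))"

lemma fill_poly:
  assumes wf: "wf_exp b" "wf_exp a" "wf_exp e" "x < nvars"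
    and fits: "fits b nvars" "fits a (nvars + 1)" "fits e (nvars + 2)"
  obtains k where "fill_time x b a e k"
proof -
  obtain kb where kb: "\<And>m M. 2 \<le> M \<Longrightarrow> bnd M m \<Longrightarrow> tm b m \<le> M ^ kb"
    using tm_poly[OF wf(1)] by blast
  obtain ka where ka: "\<And>m M. 2 \<le> M \<Longrightarrow> bnd M m \<Longrightarrow> tm (Plus a (Var x)) m \<le> M ^ ka"
    using tm_poly[of "Plus a (Var x)"] wf by auto
  obtain ke where ke: "\<And>m M. 2 \<le> M \<Longrightarrow> bnd M m \<Longrightarrow> tm e m \<le> M ^ ke"
    using tm_poly[OF wf(3)] by blast
  let ?k1 = "1 + Suc (Suc (ka + ke) + 9)"
  show thesis
  proof (rule that, unfold fill_time_def, intro allI impI)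
    fix p pc m M
    assume code: "code_at p pc (fill_comp x b a e pc)" and M: "2 \<le> (M::nat)" "bnd M m"
      and b: "ev b m \<le> M" and G: "\<forall>i<ev b m. bnd M (fill_mem x a e m i)"
    let ?t = "\<lambda>i. tm (Plus a (Var x)) (fill_mem x a e m i) + tm e (fill_mem x a e m i) + 9"
    have "?t i \<le> M ^ Suc (Suc (ka + ke) + 9)" if "i < ev b m" for i
      by (intro add_le_power M(1) ka ke G[rule_format] that le_power_self)
    then have "(\<Sum>i<ev b m. ?t i) \<le> ev b m * M ^ Suc (Suc (ka + ke) + 9)"
      using sum_bounded_above[of "{..<ev b m}" ?t "M ^ Suc (Suc (ka + ke) + 9)"] by simp
    also have "\<dots> \<le> M ^ ?k1"
      by (rule mult_le_power) (use b in simp_all)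
    finally have "tm b m + 1 + (\<Sum>i<ev b m. ?t i) + 1 \<le> M ^ Suc (Suc (Suc (kb + 1) + ?k1) + 1)"
      by (intro add_le_power M(1) kb[OF M] le_power_self)
    with fill_correct[OF wf fits code, of m]
    show "\<exists>m' T. T \<le> M ^ Suc (Suc (Suc (kb + 1) + ?k1) + 1) \<and>
       steps p T (pc, m) (pc + fill_len b a e, m') \<and>
       (\<forall>v. vis v \<longrightarrow> m' v = fill_mem x a e m (ev b m) v)"
      by blast
  qed
qed

text \<open>Syntactic bounds cannot be iterated over the passes, since the exponents would multiply.
  Instead each stored value has to be shown to stay below the same \<open>M\<close>, assuming this
  of the memory that it reads.\<close>

lemma fill_mem_bnd:
  assumes "bnd M m" "c \<le> M" "x < nvars"
    and e: "\<And>i. i < c \<Longrightarrow> bnd M (fill_mem x a e m i) \<Longrightarrow> ev e (fill_mem x a e m i) \<le> M"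
  shows "i \<le> c \<Longrightarrow> bnd M (fill_mem x a e m i)"
proof (induction i)
  case 0
  then show ?case using assms(1) by (simp add: bnd_def)
next
  case (Suc i)
  then have "bnd M (fill_mem x a e m i)" "ev e (fill_mem x a e m i) \<le> M" "Suc i \<le> M"
    using e assms(2) by auto
  then show ?case by (simp add: bnd_def Let_def)
qed

text \<open>With a constant start address no pass overwrites the cell of another, so each cell keeps
  the value computed in its own pass.\<close>

lemma fill_mem_eq:
  assumes x: "x < nvars" and a: "\<And>i. i < c \<Longrightarrow> ev a (fill_mem x a e m i) = base"
  shows "i \<le> c \<Longrightarrow> fill_mem x a e m i = (\<lambda>v. if v = x then i
    else if mem_base + base \<le> v \<and> v < mem_base + base + i
      then ev e (fill_mem x a e m (v - mem_base - base)) else m v)"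
proof (induction i)
  case 0
  show ?case by (auto simp: fun_eq_iff)
next
  case (Suc i)
  show ?case
  proof
    fix v
    consider "v = x" | "v \<noteq> x" "v = mem_base + (base + i)" | "v \<noteq> x" "v \<noteq> mem_base + (base + i)"
      by blast
    then show "fill_mem x a e m (Suc i) v = (if v = x then Suc i
      else if mem_base + base \<le> v \<and> v < mem_base + base + Suc i
        then ev e (fill_mem x a e m (v - mem_base - base)) else m v)"
    proof cases
      case 3
      have "fill_mem x a e m (Suc i) v = fill_mem x a e m i v"
        using 3 a[of i] Suc.prems by (simp add: Let_def)
      also have "\<dots> = (if mem_base + base \<le> v \<and> v < mem_base + base + i
        then ev e (fill_mem x a e m (v - mem_base - base)) else m v)"
        using Suc.IH[THEN fun_cong, of v] Suc.prems 3 by simp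
      finally show ?thesis using 3 by auto
    qed (use a[of i] Suc.prems x in \<open>simp_all add: Let_def\<close>)
  qed
qed


section \<open>Expressions for the dynamic program\<close>

text \<open>Absence of free occurrences, \<open>Sum\<close> being a binder. The derived operators
  bind fixed registers such as 8 and 9, so capture is excluded by side conditions.\<close>

fun fresh :: "nat \<Rightarrow> exp \<Rightarrow> bool" where
  "fresh x (Num c) = True"
| "fresh x (Var y) = (x \<noteq> y)"
| "fresh x (Arr e) = fresh x e"
| "fresh x (Plus a b) = (fresh x a \<and> fresh x b)"
| "fresh x (Minus a b) = (fresh x a \<and> fresh x b)"
| "fresh x (Sum y b e) = (fresh x b \<and> (x = y \<or> fresh x e))"

lemma ev_fresh: "fresh x e \<Longrightarrow> x < mem_base \<Longrightarrow> ev e (m(x := i)) = ev e m"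
proof (induction e arbitrary: m)
  case (Sum y b e)
  then have b: "ev b (m(x := i)) = ev b m" by (metis fresh.simps(6))
  have "ev e (m(x := i, y := j)) = ev e (m(y := j))" for j
  proof (cases "x = y")
    case False
    then show ?thesis
      using Sum.IH(2)[of "m(y := j)"] Sum.prems by (metis fresh.simps(6) fun_upd_twist)
  qed simp
  then show ?case unfolding ev.simps b by (intro sum.cong refl)
qed auto

lemma var_less [simp]: "i < nvars \<longleftrightarrow> i < 10" "i < mem_base \<longleftrightarrow> i < 1000"
  by (simp_all add: nvars_def mem_base_def)

definition NotE :: "exp \<Rightarrow> exp" where "NotE a = Minus (Num 1) a"
definition NzE :: "exp \<Rightarrow> exp" where "NzE a = NotE (NotE a)"
definition LeE :: "exp \<Rightarrow> exp \<Rightarrow> exp" where "LeE a b = NotE (Minus a b)"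
definition EqE :: "exp \<Rightarrow> exp \<Rightarrow> exp" where "EqE a b = NotE (Plus (Minus a b) (Minus b a))"
text \<open>Only \<open>b\<close> lies under the binder. The left factor is the bound of the sum and
  may use register 9 itself, so products nest to the left.\<close>

definition TimesE :: "exp \<Rightarrow> exp \<Rightarrow> exp" where "TimesE a b = Sum 9 a b"
definition DivE :: "exp \<Rightarrow> exp \<Rightarrow> exp" where
  "DivE a b = Sum 8 a (LeE (TimesE (Plus (Var 8) (Num 1)) b) a)"
definition ModE :: "exp \<Rightarrow> exp \<Rightarrow> exp" where "ModE a b = Minus a (TimesE (DivE a b) b)"
text \<open>The least \<open>i < b\<close> with \<open>p\<close>, where \<open>p\<close> reads \<open>i\<close> from register 5; it is \<open>b\<close> if there is none.\<close>
definition LeastE :: "exp \<Rightarrow> exp \<Rightarrow> exp" where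
  "LeastE p b = Sum 6 b (NotE (Sum 5 (Plus (Var 6) (Num 1)) p))"

lemma ev_NotE [simp]: "ev (NotE a) m = of_bool (ev a m = 0)"
  by (simp add: NotE_def)

lemma ev_NzE [simp]: "ev (NzE a) m = of_bool (ev a m \<noteq> 0)"
  by (simp add: NzE_def)

lemma ev_LeE [simp]: "ev (LeE a b) m = of_bool (ev a m \<le> ev b m)"
  by (simp add: LeE_def)

lemma ev_EqE [simp]: "ev (EqE a b) m = of_bool (ev a m = ev b m)"
  by (auto simp: EqE_def)

lemma ev_TimesE [simp]: "fresh 9 b \<Longrightarrow> ev (TimesE a b) m = ev a m * ev b m"
  by (simp add: TimesE_def ev_fresh)

lemma sum_of_bool_div:
  assumes "0 < (b::nat)"
  shows "(\<Sum>i<a. of_bool (Suc i * b \<le> a)) = a div b"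
proof -
  have iff: "Suc i * b \<le> a \<longleftrightarrow> i < a div b" for i
    using less_eq_div_iff_mult_less_eq[OF assms, of "Suc i" a] by (simp only: Suc_le_eq)
  have "{..<a} \<inter> {i. i < a div b} = {..<a div b}"
    using div_le_dividend[of a b] by (auto simp del: div_le_dividend)
  then show ?thesis unfolding iff by simp
qed

lemma ev_DivE [simp]:
  assumes "fresh 8 a" "fresh 8 b" "fresh 9 b" "0 < ev b m"
  shows "ev (DivE a b) m = ev a m div ev b m"
  using sum_of_bool_div[OF assms(4), of "ev a m"] assms(1-3)
  by (simp add: DivE_def ev_fresh)

lemma ev_ModE [simp]:
  assumes "fresh 8 a" "fresh 8 b" "fresh 9 b" "0 < ev b m"
  shows "ev (ModE a b) m = ev a m mod ev b m"
  using assms by (simp add: ModE_def minus_div_mult_eq_mod)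

definition least_below :: "nat \<Rightarrow> (nat \<Rightarrow> nat) \<Rightarrow> nat" where
  "least_below c f = (\<Sum>j<c. of_bool ((\<Sum>i<Suc j. f i) = 0))"

lemma ev_LeastE [simp]:
  assumes "fresh 6 p"
  shows "ev (LeastE p b) m = least_below (ev b m) (\<lambda>i. ev p (m(5 := i)))"
proof -
  have "ev p (m(6 := j, 5 := i)) = ev p (m(5 := i))" for i j
    using ev_fresh[OF assms, of "m(5 := i)" j] by (simp add: fun_upd_twist)
  then show ?thesis by (simp add: LeastE_def least_below_def)
qed

lemma least_below_eq:
  assumes "l \<le> c" "l < c \<Longrightarrow> f l \<noteq> 0" "\<And>i. i < l \<Longrightarrow> f i = 0"
  shows "least_below c f = l"
proof -
  have "(\<Sum>i<Suc j. f i) = 0 \<longleftrightarrow> j < l" if "j < c" for j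
  proof
    assume 0: "(\<Sum>i<Suc j. f i) = 0"
    show "j < l"
    proof (rule ccontr)
      assume "\<not> j < l"
      then have "l < Suc j" "l < c" using that by auto
      with 0 assms(2) show False by (auto simp: less_Suc_eq)
    qed
  qed (use assms(3) in auto)
  then have "least_below c f = (\<Sum>j<c. of_bool (j < l))"
    by (simp add: least_below_def)
  also have "\<dots> = card ({..<c} \<inter> {..<l})" by (simp add: lessThan_def)
  also have "{..<c} \<inter> {..<l} = {..<l}" using assms(1) by auto
  finally show ?thesis by simp
qed

lemma least_below:
  shows least_below_le: "least_below c f \<le> c"
    and least_below_nonzero: "least_below c f < c \<Longrightarrow> f (least_below c f) \<noteq> 0"
    and least_below_least: "i < c \<Longrightarrow> f i \<noteq> 0 \<Longrightarrow> least_below c f \<le> i"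
proof -
  have "least_below c f \<le> c \<and> (least_below c f < c \<longrightarrow> f (least_below c f) \<noteq> 0) \<and>
    (\<forall>i<c. f i \<noteq> 0 \<longrightarrow> least_below c f \<le> i)"
  proof (cases "\<exists>i<c. f i \<noteq> 0")
    case True
    then obtain i where i: "i < c" "f i \<noteq> 0" by blast
    have "\<exists>l. f l \<noteq> 0 \<and> (\<forall>j<l. \<not> f j \<noteq> 0)"
      by (rule exists_least_iff[THEN iffD1]) (rule exI, rule i(2))
    then obtain l where l: "f l \<noteq> 0" "\<And>j. j < l \<Longrightarrow> f j = 0" by auto
    then have "l \<le> i" using i(2) by (meson not_le)
    then have lc: "l < c" using i(1) by simp
    then have "least_below c f = l"
      using l by (intro least_below_eq) auto
    then show ?thesis using l lc by (metis less_imp_le_nat not_le)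
  next
    case False
    then have "least_below c f = c" by (intro least_below_eq) auto
    with False show ?thesis by auto
  qed
  then show "least_below c f \<le> c" "least_below c f < c \<Longrightarrow> f (least_below c f) \<noteq> 0"
    "i < c \<Longrightarrow> f i \<noteq> 0 \<Longrightarrow> least_below c f \<le> i" by blast+
qed

lemma wf_derived [simp]:
  "wf_exp (NotE a) = wf_exp a" "wf_exp (NzE a) = wf_exp a" "wf_exp (LeE a b) = (wf_exp a \<and> wf_exp b)"
  "wf_exp (EqE a b) = (wf_exp a \<and> wf_exp b)" "wf_exp (TimesE a b) = (wf_exp a \<and> wf_exp b)"
  "wf_exp (DivE a b) = (wf_exp a \<and> wf_exp b)" "wf_exp (ModE a b) = (wf_exp a \<and> wf_exp b)"
  "wf_exp (LeastE a b) = (wf_exp a \<and> wf_exp b)"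
  by (auto simp: NotE_def NzE_def LeE_def EqE_def TimesE_def DivE_def ModE_def LeastE_def)

lemma fresh_derived [simp]:
  "fresh x (NotE a) = fresh x a" "fresh x (NzE a) = fresh x a"
  "fresh x (LeE a b) = (fresh x a \<and> fresh x b)" "fresh x (EqE a b) = (fresh x a \<and> fresh x b)"
  "fresh x a \<Longrightarrow> fresh x b \<Longrightarrow> fresh x (TimesE a b)"
  "fresh x a \<Longrightarrow> fresh x b \<Longrightarrow> fresh x (DivE a b)"
  "fresh x a \<Longrightarrow> fresh x b \<Longrightarrow> fresh x (ModE a b)"
  "x = 5 \<or> fresh x a \<Longrightarrow> fresh x b \<Longrightarrow> fresh x (LeastE a b)"
  by (auto simp: NotE_def NzE_def LeE_def EqE_def TimesE_def DivE_def ModE_def LeastE_def)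

lemma fits_NotE [simp]: "fits a (k + 1) \<Longrightarrow> fits (NotE a) k"
  using fits_less[of a "k + 1"] by (simp add: NotE_def)

lemma fits_NzE [simp]:
  assumes "fits a (k + 2)"
  shows "fits (NzE a) k"
  using fits_mono[OF assms] by (simp add: NzE_def)

lemma fits_LeE [simp]:
  assumes "fits a (k + 1)" "fits b (k + 2)"
  shows "fits (LeE a b) k"
  using fits_mono[OF assms(1)] fits_mono[OF assms(2)] by (simp add: LeE_def)

lemma fits_EqE [simp]:
  assumes "fits a (k + 3)" "fits b (k + 2)"
  shows "fits (EqE a b) k"
  using fits_mono[OF assms(1)] fits_mono[OF assms(2)] by (simp add: EqE_def)

lemma fits_TimesE [simp]: "fits a k \<Longrightarrow> fits b (k + 3) \<Longrightarrow> fits (TimesE a b) k"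
  by (simp add: TimesE_def)

lemma fits_DivE [simp]:
  assumes "fits a (k + 5)" "fits b (k + 7)"
  shows "fits (DivE a b) k"
  using fits_mono[OF assms(1)] fits_mono[OF assms(2)] fits_less[OF assms(2)]
  by (simp add: DivE_def)

lemma fits_ModE [simp]:
  assumes "fits a (k + 6)" "fits b (k + 8)"
  shows "fits (ModE a b) k"
  using fits_mono[OF assms(1)] fits_mono[OF assms(2)] by (simp add: ModE_def)

lemma fits_LeastE [simp]:
  assumes "fits b k" "fits p (k + 7)"
  shows "fits (LeastE p b) k"
  using assms(1) fits_mono[OF assms(2)] fits_less[OF assms(2)] by (simp add: LeastE_def)

text \<open>Registers 0 to 2 hold \<open>n\<close>, \<open>s\<close> and \<open>t\<close>, and register 3 the packed low part of the matrix.
  Sums nest to the left, so the number of registers needed does not grow with \<open>K\<close>.\<close>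

fun PowE :: "nat \<Rightarrow> exp" where
  "PowE 0 = Num 1"
| "PowE (Suc i) = TimesE (PowE i) (Var 0)"

lemma PowE [simp]:
  "ev (PowE i) m = m 0 ^ i" "wf_exp (PowE i)" "0 < x \<Longrightarrow> fresh x (PowE i)"
  by (induction i) simp_all

lemma fits_PowE [simp]: "k < 990 \<Longrightarrow> fits (PowE i) k"
  by (induction i) simp_all

fun RepE :: "nat \<Rightarrow> exp" where
  "RepE 0 = Num 0"
| "RepE (Suc i) = Plus (TimesE (RepE i) (Var 0)) (Var 2)"

lemma RepE [simp]: "wf_exp (RepE i)" "0 < x \<Longrightarrow> x \<noteq> 2 \<Longrightarrow> fresh x (RepE i)"
  by (induction i) simp_all

lemma fits_RepE [simp]: "k < 990 \<Longrightarrow> fits (RepE i) k"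
  by (induction i) simp_all

section \<open>Adjacency, windows and transitions as expressions\<close>

text \<open>Summing over all addresses \<open>4 + k\<close> with an equality test keeps every
  divisor a constant. The shift is \<open>mem_base - 5 - k\<close> because \<open>pack\<close> makes
  cell 4 the most significant of \<open>mem_base - 4\<close> bits.\<close>

fun BitsE :: "exp \<Rightarrow> nat \<Rightarrow> exp" where
  "BitsE a 0 = Num 0"
| "BitsE a (Suc k) = Plus (BitsE a k) (TimesE (EqE a (Num (4 + k)))
     (ModE (DivE (Var 3) (Num (2 ^ (mem_base - 5 - k)))) (Num 2)))"

lemma BitsE [simp]: "wf_exp (BitsE a i) = (i = 0 \<or> wf_exp a)" "3 < x \<Longrightarrow> fresh x a \<Longrightarrow> fresh x (BitsE a i)"
  by (induction i) auto

lemma fits_BitsE [simp]: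
  assumes "fits a (k + 30)"
  shows "fits (BitsE a i) k"
  using fits_mono[OF assms] fits_less[OF assms] by (induction i) simp_all

lemma ev_BitsE:
  assumes "fresh 8 a" "fresh 9 a"
  shows "ev (BitsE a i) m =
    (if 4 \<le> ev a m \<and> ev a m < 4 + i then m 3 div 2 ^ (mem_base - 1 - ev a m) mod 2 else 0)"
  using assms by (induction i) auto

text \<open>At most one term is nonzero: addresses from \<open>mem_base\<close> on still hold the
  matrix, and those from 4 up to there are found in the packed bits. Address 3 yields 0.\<close>

definition AdjE :: "exp \<Rightarrow> exp \<Rightarrow> exp" where
  "AdjE u v = (let a = Plus (Num 3) (Plus (TimesE u (Var 0)) v) in
     Plus (TimesE (LeE (Num mem_base) a) (Arr (Minus a (Num mem_base))))
       (BitsE a (mem_base - 4)))"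

lemma AdjE [simp]:
  "wf_exp u \<Longrightarrow> wf_exp v \<Longrightarrow> wf_exp (AdjE u v)"
  "3 < x \<Longrightarrow> fresh x u \<Longrightarrow> fresh x v \<Longrightarrow> fresh x (AdjE u v)"
  by (simp_all add: AdjE_def Let_def)

lemma fits_AdjE [simp]:
  assumes "fits u (k + 40)" "fits v (k + 40)"
  shows "fits (AdjE u v) k"
  using fits_mono[OF assms(1)] fits_mono[OF assms(2)] fits_less[OF assms(1)]
  by (simp add: AdjE_def Let_def)

definition NbE :: "exp \<Rightarrow> exp \<Rightarrow> exp" where
  "NbE u v = NzE (Plus (EqE u v) (AdjE u v))"

lemma NbE [simp]:
  "wf_exp u \<Longrightarrow> wf_exp v \<Longrightarrow> wf_exp (NbE u v)"
  "3 < x \<Longrightarrow> fresh x u \<Longrightarrow> fresh x v \<Longrightarrow> fresh x (NbE u v)"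
  by (simp_all add: NbE_def)

lemma fits_NbE [simp]:
  assumes "fits u (k + 50)" "fits v (k + 50)"
  shows "fits (NbE u v) k"
  using fits_mono[OF assms(1)] fits_mono[OF assms(2)] fits_less[OF assms(1)]
  by (simp add: NbE_def)

text \<open>Only the test for 0 is used later, so windows with repeated vertices do no harm.\<close>

fun WinE :: "exp \<Rightarrow> nat \<Rightarrow> exp" where
  "WinE q 0 = Num 0"
| "WinE q (Suc i) = Plus (WinE q i) (NbE (ModE (DivE q (PowE i)) (Var 0)) (Var 7))"

lemma WinE [simp]:
  "wf_exp q \<Longrightarrow> wf_exp (WinE q i)"
  "3 < x \<Longrightarrow> x \<noteq> 7 \<Longrightarrow> fresh x q \<Longrightarrow> fresh x (WinE q i)"
  by (induction i) simp_all

lemma fits_WinE [simp]: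
  assumes "fits q (k + 80)"
  shows "fits (WinE q i) k"
  using fits_mono[OF assms] fits_less[OF assms] by (induction i) simp_all

definition NewE :: "nat \<Rightarrow> exp \<Rightarrow> exp \<Rightarrow> exp" where
  "NewE K q v = Sum 7 (Var 0) (TimesE (NbE v (Var 7)) (NotE (WinE q K)))"

lemma NewE [simp]:
  "wf_exp q \<Longrightarrow> wf_exp v \<Longrightarrow> wf_exp (NewE K q v)"
  "3 < x \<Longrightarrow> fresh x q \<Longrightarrow> fresh x v \<Longrightarrow> fresh x (NewE K q v)"
  by (simp_all add: NewE_def) (cases "x = 7"; simp)

lemma fits_NewE [simp]:
  assumes "fits q (k + 100)" "fits v (k + 100)"
  shows "fits (NewE K q v) k"
  using fits_mono[OF assms(1)] fits_mono[OF assms(2)] fits_less[OF assms(1)]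
  by (simp add: NewE_def)

definition NxtE :: "nat \<Rightarrow> exp \<Rightarrow> exp \<Rightarrow> exp" where
  "NxtE K q v = Plus
     (TimesE (Plus (Plus (DivE q (PowE K)) (TimesE (Var 0) (NewE K q v))) (Num 1)) (PowE K))
     (ModE (Plus (TimesE q (Var 0)) v) (PowE K))"

lemma NxtE [simp]:
  "wf_exp q \<Longrightarrow> wf_exp v \<Longrightarrow> wf_exp (NxtE K q v)"
  "3 < x \<Longrightarrow> fresh x q \<Longrightarrow> fresh x v \<Longrightarrow> fresh x (NxtE K q v)"
  by (simp_all add: NxtE_def)

lemma fits_NxtE [simp]:
  assumes "fits q (k + 120)" "fits v (k + 120)"
  shows "fits (NxtE K q v) k"
  using fits_mono[OF assms(1)] fits_mono[OF assms(2)] fits_less[OF assms(1)]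
  by (simp add: NxtE_def)

definition InitE :: "nat \<Rightarrow> exp" where
  "InitE K = Plus (TimesE (TimesE (Var 0) (Sum 7 (Var 0) (NbE (Var 2) (Var 7)))) (PowE K)) (RepE K)"

lemma InitE [simp]: "wf_exp (InitE K)" "3 < x \<Longrightarrow> fresh x (InitE K)"
  by (simp_all add: InitE_def) (cases "x = 7"; simp)

lemma fits_InitE [simp]: "k < 900 \<Longrightarrow> fits (InitE K) k"
  by (simp add: InitE_def)

section \<open>Memory layout and the bodies of the loops\<close>

text \<open>Offsets count from \<open>mem_base\<close>. The matrix ends before address
  \<open>n * n + 3\<close>, so table, chain and output, all from \<open>mem_base + n * n + 3\<close>
  on, leave it intact.\<close>

definition TabBaseE :: exp where "TabBaseE = Plus (TimesE (Var 0) (Var 0)) (Num 3)"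
definition TabSizeE :: "nat \<Rightarrow> exp" where
  "TabSizeE K = TimesE (TimesE (Var 0) (Plus (Var 0) (Num 1))) (PowE K)"

lemma TabBaseE [simp]:
  "ev TabBaseE m = m 0 * m 0 + 3" "wf_exp TabBaseE" "0 < x \<Longrightarrow> fresh x TabBaseE"
  "k < 900 \<Longrightarrow> fits TabBaseE k"
  by (simp_all add: TabBaseE_def)

lemma TabSizeE [simp]:
  "ev (TabSizeE K) m = m 0 * (m 0 + 1) * m 0 ^ K" "wf_exp (TabSizeE K)" "0 < x \<Longrightarrow> fresh x (TabSizeE K)"
  "k < 900 \<Longrightarrow> fits (TabSizeE K) k"
  by (simp_all add: TabSizeE_def)

definition PredE :: "nat \<Rightarrow> exp" where
  "PredE K = TimesE (NzE (Arr (Plus TabBaseE (Var 5))))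
     (TimesE (AdjE (ModE (Var 4) (Var 0)) (ModE (Var 5) (Var 0)))
       (EqE (Var 4) (NxtE K (Var 5) (ModE (Var 4) (Var 0)))))"

lemma PredE [simp]:
  "wf_exp (PredE K)" "5 < x \<Longrightarrow> fresh x (PredE K)" "k < 700 \<Longrightarrow> fits (PredE K) k"
  by (simp_all add: PredE_def)

text \<open>The entry of \<open>init\<close> points to itself. For other states a search that finds
  no predecessor returns its bound \<open>Var 4\<close>, and then the entry is 0.\<close>

definition TabE :: "nat \<Rightarrow> exp" where
  "TabE K = (let l = LeastE (PredE K) (Var 4) in
     Plus (TimesE (EqE (Var 4) (InitE K)) (Plus (Var 4) (Num 1)))
       (TimesE (NotE (EqE (Var 4) (InitE K)))
         (TimesE (NotE (LeE (Var 4) l)) (Plus l (Num 1)))))"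

lemma TabE [simp]: "wf_exp (TabE K)" "k < 600 \<Longrightarrow> fits (TabE K) k"
  by (simp_all add: TabE_def Let_def)

definition ChainBaseE :: "nat \<Rightarrow> exp" where "ChainBaseE K = Plus TabBaseE (TabSizeE K)"

definition GoalE :: exp where
  "GoalE = TimesE (NzE (Arr (Plus TabBaseE (Var 5)))) (EqE (ModE (Var 5) (Var 0)) (Var 1))"

definition ChainE :: "nat \<Rightarrow> exp" where
  "ChainE K = Plus (TimesE (NotE (Var 4)) (LeastE GoalE (TabSizeE K)))
     (TimesE (NzE (Var 4))
       (Minus (Arr (Plus TabBaseE (Arr (Minus (Plus (ChainBaseE K) (Var 4)) (Num 1))))) (Num 1)))"

lemma ChainBaseE [simp]:
  "ev (ChainBaseE K) m = m 0 * m 0 + 3 + m 0 * (m 0 + 1) * m 0 ^ K"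
  "wf_exp (ChainBaseE K)" "0 < x \<Longrightarrow> fresh x (ChainBaseE K)" "k < 800 \<Longrightarrow> fits (ChainBaseE K) k"
  by (simp_all add: ChainBaseE_def)

lemma GoalE [simp]: "wf_exp GoalE" "5 < x \<Longrightarrow> fresh x GoalE" "k < 700 \<Longrightarrow> fits GoalE k"
  by (simp_all add: GoalE_def)

lemma ChainE [simp]: "wf_exp (ChainE K)" "k < 600 \<Longrightarrow> fits (ChainE K) k"
  by (simp_all add: ChainE_def)

definition OutBaseE :: "nat \<Rightarrow> exp" where "OutBaseE K = Plus (ChainBaseE K) (Var 0)"

text \<open>Cell 0 is the length that \<open>decode\<close> expects: one more than the length
  component of the goal, or 0 if the goal search ran out at \<open>Q\<close>. Surplus chain entries
  lie beyond that length.\<close>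

definition OutE :: "nat \<Rightarrow> exp" where
  "OutE K = Plus
     (TimesE (NotE (Var 4)) (TimesE (NotE (LeE (TabSizeE K) (Arr (ChainBaseE K))))
       (Plus (ModE (DivE (Arr (ChainBaseE K)) (PowE K)) (Var 0)) (Num 1))))
     (TimesE (NzE (Var 4)) (ModE (Arr (Minus (Plus (ChainBaseE K) (Var 4)) (Num 1))) (Var 0)))"

lemma OutBaseE [simp]:
  "ev (OutBaseE K) m = m 0 * m 0 + 3 + m 0 * (m 0 + 1) * m 0 ^ K + m 0"
  "wf_exp (OutBaseE K)" "0 < x \<Longrightarrow> fresh x (OutBaseE K)" "k < 700 \<Longrightarrow> fits (OutBaseE K) k"
  by (simp_all add: OutBaseE_def)

lemma OutE [simp]: "wf_exp (OutE K)" "k < 600 \<Longrightarrow> fits (OutE K) k"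
  by (simp_all add: OutE_def)

text \<open>The answer has to start at cell 0, so its part from index \<open>mem_base\<close> on
  belongs at the start of the array. The shift down ends below the output area, so no source is
  overwritten; the matrix is sacrificed.\<close>

definition CopyE :: "nat \<Rightarrow> exp" where
  "CopyE K = Arr (Plus (OutBaseE K) (Plus (Num mem_base) (Var 4)))"

lemma CopyE [simp]: "wf_exp (CopyE K)" "k < 600 \<Longrightarrow> fits (CopyE K) k"
  by (simp_all add: CopyE_def)


section \<open>The stages of the program\<close>

fun pack :: "(nat \<Rightarrow> nat) \<Rightarrow> nat \<Rightarrow> nat" where
  "pack f 0 = 0"
| "pack f (Suc j) = 2 * pack f j + f j"

lemma pack_bit:
  assumes "\<And>k. f k \<le> 1"
  shows "k < j \<Longrightarrow> pack f j div 2 ^ (j - 1 - k) mod 2 = f k"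
proof (induction j)
  case (Suc j)
  have f: "f i mod 2 = f i" "f i div 2 = 0" for i using assms[of i] by auto
  show ?case
  proof (cases "k = j")
    case True
    then show ?thesis using f by simp
  next
    case False
    then have "j - k = Suc (j - 1 - k)" "k < j" using Suc.prems by auto
    then show ?thesis
      using Suc.IH f by (simp add: div_mult2_eq)
  qed
qed simp

lemma pack_less: "(\<And>k. f k \<le> 1) \<Longrightarrow> pack f j < 2 ^ j"
proof (induction j)
  case (Suc j)
  have "f j \<le> 1" "pack f j < 2 ^ j" using Suc by blast+
  then show ?case by simp
qed simp

lemma fill_mem_reg: "v < nvars \<Longrightarrow> v \<noteq> x \<Longrightarrow> fill_mem x a e m i v = m v"
  by (induction i) (simp_all add: Let_def mem_base_def)

lemma mem_base_neq [simp]: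
  "mem_base \<noteq> 0" "mem_base + a \<noteq> 4" "mem_base + a + b \<noteq> 4" "mem_base + a \<noteq> 5" "mem_base + a + b \<noteq> 5"
  by (simp_all add: mem_base_def)

text \<open>The memory just before pass \<open>i\<close> of a fill loop, in terms of the memories before and
  after the whole loop.\<close>

definition mid :: "(nat \<Rightarrow> nat) \<Rightarrow> (nat \<Rightarrow> nat) \<Rightarrow> nat \<Rightarrow> nat \<Rightarrow> nat \<Rightarrow> nat \<Rightarrow> nat" where
  "mid m m' base c i = (\<lambda>v. if v = 4 then i
     else if mem_base + base + i \<le> v \<and> v < mem_base + base + c then m v else m' v)"

text \<open>Through \<open>mid\<close>, pass \<open>i\<close> sees the final values of all earlier
  entries. A finished loop is thus described by recursion equations between its entries, without
  \<open>fill_mem\<close>.\<close>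

definition filled :: "exp \<Rightarrow> nat \<Rightarrow> nat \<Rightarrow> (nat \<Rightarrow> nat) \<Rightarrow> (nat \<Rightarrow> nat) \<Rightarrow> bool" where
  "filled e base c m m' \<longleftrightarrow>
     (\<forall>v. vis v \<and> v \<noteq> 4 \<and> \<not> (mem_base + base \<le> v \<and> v < mem_base + base + c) \<longrightarrow> m' v = m v) \<and>
     (\<forall>i<c. m' (mem_base + base + i) = ev e (mid m m' base c i))"

lemma fill_mem_filled:
  assumes wf: "wf_exp e" and a: "\<And>m'. m' 0 = m 0 \<Longrightarrow> ev a m' = base"
    and m': "\<And>v. vis v \<Longrightarrow> m' v = fill_mem 4 a e m c v"
  shows "filled e base c m m'" and "i < c \<Longrightarrow> ev e (fill_mem 4 a e m i) = m' (mem_base + base + i)"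
proof -
  have eq: "fill_mem 4 a e m i = (\<lambda>v. if v = 4 then i
    else if mem_base + base \<le> v \<and> v < mem_base + base + i
      then ev e (fill_mem 4 a e m (v - mem_base - base)) else m v)" if "i \<le> c" for i
    by (rule fill_mem_eq[of 4 c]) (use that in \<open>auto intro!: a fill_mem_reg\<close>)
  have v: "vis (mem_base + base + i)" for i by (simp add: vis_def)
  have val: "m' (mem_base + base + i) = ev e (fill_mem 4 a e m i)" if "i < c" for i
  proof -
    have "mem_base + base + i \<noteq> 4" by (simp add: mem_base_def)
    then show ?thesis
      using eq[of c, THEN fun_cong, of "mem_base + base + i"] m'[OF v, of i] that by simp
  qed
  then show "i < c \<Longrightarrow> ev e (fill_mem 4 a e m i) = m' (mem_base + base + i)" by simp
  have "ev e (fill_mem 4 a e m i) = ev e (mid m m' base c i)" if "i < c" for i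
  proof (rule ev_cong[OF wf], intro allI impI)
    fix v assume "vis v"
    then show "fill_mem 4 a e m i v = mid m m' base c i v"
      using eq[of i, THEN fun_cong, of v] eq[of c, THEN fun_cong, of v] m'[of v] that
      by (auto simp: mid_def)
  qed
  with val have "\<forall>i<c. m' (mem_base + base + i) = ev e (mid m m' base c i)" by simp
  moreover have "\<forall>v. vis v \<and> v \<noteq> 4 \<and> \<not> (mem_base + base \<le> v \<and> v < mem_base + base + c) \<longrightarrow>
      m' v = m v"
    using m' eq[of c, THEN fun_cong] by auto
  ultimately show "filled e base c m m'" unfolding filled_def by blast
qed

context secluded
begin

abbreviation "enc \<equiv> encode n E s t"

definition X :: nat where "X = pack (\<lambda>k. enc (4 + k)) (mem_base - 4)"

definition inp :: "(nat \<Rightarrow> nat) \<Rightarrow> bool" where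
  "inp m \<longleftrightarrow> m 0 = n \<and> m 1 = s \<and> m 2 = t \<and> m 3 = X \<and>
     (\<forall>a. mem_base \<le> a \<and> a < 3 + n * n \<longrightarrow> m a = enc a)"

lemma inpD: "inp m \<Longrightarrow> m 0 = n" "inp m \<Longrightarrow> m (Suc 0) = s" "inp m \<Longrightarrow> m 2 = t" "inp m \<Longrightarrow> m 3 = X"
  by (auto simp: inp_def)

lemma inp_upd [simp]: "3 < x \<Longrightarrow> x < 10 \<Longrightarrow> inp (m(x := i)) = inp m"
  by (auto simp: inp_def mem_base_def)

lemma enc_edge:
  assumes "u < n" "v < n"
  shows "enc (3 + (u * n + v)) = of_bool (E u v)" "3 + (u * n + v) < 3 + n * n"
proof -
  have "u * n + v < Suc u * n" using assms by simp
  also have "\<dots> \<le> n * n" using assms by (intro mult_right_mono) simp_all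
  finally show "3 + (u * n + v) < 3 + n * n" by simp
  then show "enc (3 + (u * n + v)) = of_bool (E u v)"
    using assms by (simp add: encode_def)
qed

lemma enc_le: "3 \<le> a \<Longrightarrow> enc a \<le> 1"
  by (simp add: encode_def)

lemma ev_AdjE:
  assumes m: "inp m" and fr: "fresh 8 u" "fresh 9 u" "fresh 8 v" "fresh 9 v"
    and less: "ev u m < n" "ev v m < n"
  shows "ev (AdjE u v) m = of_bool (E (ev u m) (ev v m))"
proof -
  let ?a = "3 + (ev u m * n + ev v m)"
  have enc: "enc ?a = of_bool (E (ev u m) (ev v m))" "?a < 3 + n * n"
    using enc_edge[OF less] by auto
  have ev: "ev (AdjE u v) m = of_bool (mem_base \<le> ?a) * m (mem_base + (?a - mem_base)) +
      (if 4 \<le> ?a \<and> ?a < 4 + (mem_base - 4) then X div 2 ^ (mem_base - 1 - ?a) mod 2 else 0)"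
    using fr m by (simp add: AdjE_def Let_def ev_BitsE inpD)
  consider "mem_base \<le> ?a" | "?a = 3" | "4 \<le> ?a" "?a < mem_base" by linarith
  then show ?thesis
  proof cases
    case 1
    then have "ev (AdjE u v) m = m ?a" unfolding ev by (simp add: mem_base_def)
    then show ?thesis using m enc 1 by (simp add: inp_def)
  next
    case 2
    \<comment> \<open>Address 3 arises only from the pair of vertices 0 and 0, which irreflexivity
      excludes as an edge.\<close>
    then have "ev u m = 0 \<and> ev v m = 0" using less by simp
    moreover have "\<not> E 0 0" using graph n_pos by (simp add: simple_graph_def)
    moreover have "ev (AdjE u v) m = 0" unfolding ev 2 by (simp add: mem_base_def)
    ultimately show ?thesis by simp
  next
    case 3
    have "mem_base - 1 - ?a = mem_base - 4 - 1 - (?a - 4)" using 3 by simp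
    moreover have "?a - 4 < mem_base - 4" using 3 by linarith
    then have "X div 2 ^ (mem_base - 4 - 1 - (?a - 4)) mod 2 = enc (4 + (?a - 4))"
      unfolding X_def by (intro pack_bit enc_le) simp_all
    ultimately have "X div 2 ^ (mem_base - 1 - ?a) mod 2 = enc ?a" using 3(1) by simp
    moreover have "4 + (mem_base - 4) = mem_base" by (simp add: mem_base_def)
    moreover have "\<not> mem_base \<le> ?a" using 3 by linarith
    ultimately have "ev (AdjE u v) m = enc ?a" unfolding ev using 3 by (simp only:) simp
    then show ?thesis using enc by simp
  qed
qed

lemma ev_NbE:
  assumes "inp m" "fresh 8 u" "fresh 9 u" "fresh 8 v" "fresh 9 v" "ev u m < n" "ev v m < n"
  shows "ev (NbE u v) m = of_bool (ev v m \<in> Nb (ev u m))"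
  using assms by (auto simp: NbE_def ev_AdjE closed_nbh_def)

lemma ev_WinE:
  assumes "inp m" "fresh 8 q" "fresh 9 q" "m 7 < n"
  shows "ev (WinE q i) m = 0 \<longleftrightarrow> (\<forall>j<i. m 7 \<notin> Nb (dig (ev q m) j))"
proof (induction i)
  case (Suc i)
  have "ev (ModE (DivE q (PowE i)) (Var 0)) m = dig (ev q m) i"
    using assms n_pos by (simp add: inpD dig_def)
  then have "ev (NbE (ModE (DivE q (PowE i)) (Var 0)) (Var 7)) m = of_bool (m 7 \<in> Nb (dig (ev q m) i))"
    using assms ev_NbE[of m "ModE (DivE q (PowE i)) (Var 0)" "Var 7"] by (simp add: dig_less)
  with Suc show ?case by (auto simp: less_Suc_eq)
qed simp

lemma ev_NewE:
  assumes m: "inp m" and fr: "fresh 7 q" "fresh 8 q" "fresh 9 q" "fresh 7 v" "fresh 8 v" "fresh 9 v"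
    and less: "ev v m < n"
  shows "ev (NewE K q v) m = w (ev q m) (ev v m)"
proof -
  have up: "ev q (m(7 := x)) = ev q m" "ev v (m(7 := x)) = ev v m" for x
    using fr by (simp_all add: ev_fresh)
  define B where "B = Nb (ev v m) - (\<Union>i<K. Nb (dig (ev q m) i))"
  have "ev (TimesE (NbE v (Var 7)) (NotE (WinE q K))) (m(7 := x)) = of_bool (x \<in> B)"
    if "x < n" for x
    using that m fr less ev_NbE[of "m(7 := x)" v "Var 7"] ev_WinE[of "m(7 := x)" q K] up[of x]
    by (auto simp: B_def)
  then have "ev (NewE K q v) m = (\<Sum>x<n. of_bool (x \<in> B))"
    using m by (simp add: NewE_def inpD)
  also have "\<dots> = card ({..<n} \<inter> B)" by simp
  also have "{..<n} \<inter> B = B" using Nb_subset[OF less] by (auto simp: B_def)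
  finally show ?thesis by (simp add: w_def B_def)
qed

lemma ev_NxtE:
  assumes m: "inp m" and fr: "fresh 7 q" "fresh 8 q" "fresh 9 q" "fresh 7 v" "fresh 8 v" "fresh 9 v"
    and less: "ev v m < n"
  shows "ev (NxtE K q v) m = nxt (ev q m) (ev v m)"
  using assms n_pos by (simp add: NxtE_def ev_NewE nxt_def N_def inpD)

lemma ev_RepE: "inp m \<Longrightarrow> ev (RepE i) m = rep i"
  by (induction i) (simp_all add: inpD)

lemma ev_InitE:
  assumes m: "inp m"
  shows "ev (InitE K) m = init"
proof -
  have "ev (NbE (Var 2) (Var 7)) (m(7 := x)) = of_bool (x \<in> Nb t)" if "x < n" for x
    using that m t_less ev_NbE[of "m(7 := x)" "Var 2" "Var 7"] by (simp add: inpD)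
  then have "ev (Sum 7 (Var 0) (NbE (Var 2) (Var 7))) m = (\<Sum>x<n. of_bool (x \<in> Nb t))"
    using m by (simp add: inpD)
  also have "\<dots> = card ({..<n} \<inter> Nb t)" by simp
  also have "{..<n} \<inter> Nb t = Nb t" using Nb_subset[OF t_less] by auto
  finally show ?thesis
    using m by (simp add: InitE_def init_def N_def inpD ev_RepE del: ev.simps(6))
qed

section \<open>What each stage leaves in memory\<close>

definition tab_base :: nat where "tab_base = n * n + 3"
definition chain_base :: nat where "chain_base = tab_base + Q"
definition out_base :: nat where "out_base = chain_base + n"

lemma ev_bases:
  assumes "m 0 = n"
  shows "ev TabBaseE m = tab_base" "ev (TabSizeE K) m = Q" "ev (ChainBaseE K) m = chain_base"
    "ev (OutBaseE K) m = out_base"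
  using assms by (simp_all add: tab_base_def Q_def N_def chain_base_def out_base_def)

abbreviation tab :: "(nat \<Rightarrow> nat) \<Rightarrow> nat \<Rightarrow> nat" where
  "tab m q \<equiv> m (mem_base + tab_base + q)"

lemma inp_filled:
  assumes "inp m" "filled e base c m m'" "tab_base \<le> base"
  shows "inp m'"
  using assms by (auto simp: inp_def filled_def vis_def tab_base_def mem_base_def nvars_def)

lemma inp_mid:
  assumes "inp m'" "tab_base \<le> base"
  shows "inp (mid m m' base c i)"
  using assms by (auto simp: inp_def mid_def tab_base_def mem_base_def)

lemma ev_PredE:
  assumes "inp m"
  shows "ev (PredE K) m = of_bool (pred_ok (tab m) (m 5) (m 4))"
  using assms n_pos
  by (auto simp: PredE_def ev_AdjE ev_NxtE inpD pred_ok_def tab_base_def add.assoc)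

lemma ev_TabE:
  assumes m: "inp m"
  defines "l \<equiv> least_below (m 4) (\<lambda>i. of_bool (pred_ok (tab m) i (m 4)))"
  shows "ev (TabE K) m = (if m 4 = init then m 4 + 1 else if l < m 4 then l + 1 else 0)"
proof -
  have "ev (PredE K) (m(5 := i)) = of_bool (pred_ok (tab m) i (m 4))" for i
    using m by (subst ev_PredE) simp_all
  then have "ev (LeastE (PredE K) (Var 4)) m = l" by (simp add: l_def)
  then show ?thesis using m by (simp add: TabE_def Let_def ev_InitE)
qed

text \<open>Pass \<open>q\<close> searches only entries below \<open>q\<close>, where the
  intermediate memory agrees with the final one; hence the final table satisfies its own
  recursion.\<close>

lemma table_stage:
  assumes m: "inp m" and f: "filled (TabE K) tab_base Q m m'"
  shows "is_table (tab m')" "q < Q \<Longrightarrow> tab m' q \<le> q + 1"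
proof -
  have m': "inp m'" using inp_filled[OF m f] by simp
  define l where "l q = least_below q (\<lambda>i. of_bool (pred_ok (tab m') i q))" for q
  have eq: "tab m' q = (if q = init then q + 1 else if l q < q then l q + 1 else 0)"
    if "q < Q" for q
  proof -
    let ?m = "mid m m' tab_base Q q"
    have 4: "?m 4 = q" by (simp add: mid_def)
    have "tab ?m i = tab m' i" if "i < q" for i
      using that by (simp add: mid_def mem_base_def)
    then have "pred_ok (tab ?m) i q = pred_ok (tab m') i q" if "i < q" for i
      using that by (simp add: pred_ok_def)
    then have "least_below q (\<lambda>i. of_bool (pred_ok (tab ?m) i q)) = l q"
      unfolding l_def least_below_def by (intro sum.cong arg_cong[of _ _ of_bool]) auto
    with ev_TabE[OF inp_mid[OF m', of tab_base m Q q]]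
    have "ev (TabE K) ?m = (if q = init then q + 1 else if l q < q then l q + 1 else 0)"
      unfolding 4 by simp
    then show ?thesis using f that by (simp add: filled_def)
  qed
  show "q < Q \<Longrightarrow> tab m' q \<le> q + 1"
    using eq least_below_le[of q] by (simp add: l_def)
  show "is_table (tab m')"
    unfolding is_table_def
  proof (intro allI impI conjI)
    fix q assume q: "q < Q"
    show "tab m' q \<noteq> 0" if "q = init" using eq[OF q] that by simp
    {
      assume "q \<noteq> init \<and> tab m' q \<noteq> 0"
      then have lq: "l q < q" "tab m' q - 1 = l q" using eq[OF q] by (auto split: if_splits)
      then show "tab m' q - 1 < q" by simp
      show "pred_ok (tab m') (tab m' q - 1) q"
        using least_below_nonzero[of q "\<lambda>i. of_bool (pred_ok (tab m') i q)"] lq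
        by (simp add: l_def)
    }
    fix q' assume "q' < q" "pred_ok (tab m') q' q"
    then have "l q \<le> q'" unfolding l_def by (intro least_below_least) auto
    then show "tab m' q \<noteq> 0" using eq[OF q] \<open>q' < q\<close> by simp
  qed
qed

definition goal :: "(nat \<Rightarrow> nat) \<Rightarrow> nat" where
  "goal T = least_below Q (\<lambda>q. of_bool (T q \<noteq> 0 \<and> q mod n = s))"

lemma ev_ChainE:
  assumes m: "inp m"
  shows "ev (ChainE K) m = (if m 4 = 0 then goal (tab m)
    else tab m (m (mem_base + chain_base + m 4 - 1)) - 1)"
proof -
  have "ev GoalE (m(5 := i)) = of_bool (tab m i \<noteq> 0 \<and> i mod n = s)" for i
    using m n_pos ev_bases(1)[of "m(5 := i)"]
    by (auto simp: GoalE_def inpD add.assoc simp del: TabBaseE(1))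
  then have 1: "ev (LeastE GoalE (TabSizeE K)) m = goal (tab m)"
    using m ev_bases(2)[of m] by (simp add: goal_def inpD del: TabSizeE(1))
  show ?thesis
    using m 1 ev_bases[of m]
    by (simp add: ChainE_def inpD add.assoc del: TabBaseE(1) ChainBaseE(1) ev_LeastE)
qed

lemma chain_stage:
  assumes m: "inp m" and f: "filled (ChainE K) chain_base n m m'"
  shows "q < Q \<Longrightarrow> tab m' q = tab m q"
    and "m' (mem_base + chain_base) = goal (tab m)"
    and "Suc j < n \<Longrightarrow> m' (mem_base + chain_base + j) < Q \<Longrightarrow>
      m' (mem_base + chain_base + Suc j) = tab m (m' (mem_base + chain_base + j)) - 1"
proof -
  have m': "inp m'" using inp_filled[OF m f] by (simp add: chain_base_def)
  have same: "tab m' q = tab m q" if "q < Q" for q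
  proof -
    have "vis (mem_base + tab_base + q)" "mem_base + tab_base + q \<noteq> 4"
      "\<not> mem_base + chain_base \<le> mem_base + tab_base + q"
      using that by (simp_all add: vis_def chain_base_def mem_base_def)
    then show ?thesis using f by (simp add: filled_def)
  qed
  show "q < Q \<Longrightarrow> tab m' q = tab m q" by (rule same)
  have mt: "tab (mid m m' chain_base n j) q = tab m q" if "q < Q" for q j
    using same[OF that] that by (simp add: mid_def mem_base_def)
  have ev: "m' (mem_base + chain_base + j) = (if j = 0 then goal (tab (mid m m' chain_base n j))
      else tab (mid m m' chain_base n j)
        (mid m m' chain_base n j (mem_base + chain_base + j - 1)) - 1)" if "j < n" for j
    using ev_ChainE[OF inp_mid[OF m', of chain_base m n j]] f that
    by (simp add: filled_def chain_base_def) (simp add: mid_def)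
  have "goal (tab (mid m m' chain_base n 0)) = goal (tab m)"
    unfolding goal_def least_below_def
    by (intro sum.cong arg_cong[of _ _ of_bool]) (auto simp: mt)
  then show "m' (mem_base + chain_base) = goal (tab m)"
    using ev[of 0] n_pos by simp
  assume j: "Suc j < n" "m' (mem_base + chain_base + j) < Q"
  have "mid m m' chain_base n (Suc j) (mem_base + chain_base + j) = m' (mem_base + chain_base + j)"
    by (simp add: mid_def mem_base_def)
  then show "m' (mem_base + chain_base + Suc j) = tab m (m' (mem_base + chain_base + j)) - 1"
    using ev[OF j(1)] mt[OF j(2), of "Suc j"] by simp
qed

lemma ev_OutE:
  assumes m: "inp m"
  shows "ev (OutE K) m = (if m 4 = 0
    then (if m (mem_base + chain_base) < Q then m (mem_base + chain_base) div N mod n + 1 else 0)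
    else m (mem_base + chain_base + m 4 - 1) mod n)"
  using m n_pos ev_bases[of m]
  by (auto simp: OutE_def inpD N_def add.assoc simp del: TabSizeE(1) ChainBaseE(1))

lemma out_stage:
  assumes m: "inp m" and f: "filled (OutE K) out_base (n + 1) m m'"
  shows "m' (mem_base + out_base) = (if m (mem_base + chain_base) < Q
      then m (mem_base + chain_base) div N mod n + 1 else 0)"
    and "j < n \<Longrightarrow> m' (mem_base + out_base + Suc j) = m (mem_base + chain_base + j) mod n"
proof -
  have m': "inp m'" using inp_filled[OF m f] by (simp add: chain_base_def out_base_def)
  have mc: "mid m m' out_base (n + 1) i (mem_base + chain_base + j) = m (mem_base + chain_base + j)"
    if "j < n" for i j
  proof -
    have "vis (mem_base + chain_base + j)" "mem_base + chain_base + j \<noteq> 4"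
      "\<not> mem_base + out_base \<le> mem_base + chain_base + j"
      using that by (simp_all add: vis_def out_base_def mem_base_def)
    then show ?thesis using f by (simp add: filled_def mid_def)
  qed
  have ev: "m' (mem_base + out_base + i) = (let c = mid m m' out_base (n + 1) i in if i = 0
    then (if c (mem_base + chain_base) < Q then c (mem_base + chain_base) div N mod n + 1 else 0)
    else c (mem_base + chain_base + i - 1) mod n)" if "i < n + 1" for i
    using ev_OutE[OF inp_mid[OF m', of out_base m "n + 1" i]] f that
    by (simp add: filled_def chain_base_def out_base_def Let_def) (simp add: mid_def)
  show "m' (mem_base + out_base) = (if m (mem_base + chain_base) < Q
      then m (mem_base + chain_base) div N mod n + 1 else 0)"
    using ev[of 0] mc[of 0 0] n_pos by (simp add: Let_def)
  show "j < n \<Longrightarrow> m' (mem_base + out_base + Suc j) = m (mem_base + chain_base + j) mod n"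
    using ev[of "Suc j"] mc[of j "Suc j"] by (simp add: Let_def)
qed

lemma ev_CopyE: "m 0 = n \<Longrightarrow> ev (CopyE K) m = m (mem_base + out_base + (mem_base + m 4))"
  using ev_bases(4)[of m] by (simp add: CopyE_def add.assoc del: OutBaseE(1))

lemma copy_stage:
  assumes m: "inp m" and f: "filled (CopyE K) 0 n m m'"
  shows "m' (mem_base + out_base + i) = m (mem_base + out_base + i)"
    and "j < n \<Longrightarrow> m' (mem_base + j) = m (mem_base + out_base + (mem_base + j))"
    and "m' 0 = n"
proof -
  have big: "n \<le> out_base" by (simp add: out_base_def)
  have "vis (mem_base + out_base + i)" "mem_base + out_base + i \<noteq> 4"
      "\<not> mem_base + out_base + i < mem_base + n" for i
    using big by (simp_all add: vis_def mem_base_def)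
  then have same: "m' (mem_base + out_base + i) = m (mem_base + out_base + i)" for i
    using f by (simp add: filled_def)
  show "m' (mem_base + out_base + i) = m (mem_base + out_base + i)" by (rule same)
  show m'0: "m' 0 = n"
    using f m by (simp add: filled_def vis_def inpD mem_base_def)
  assume j: "j < n"
  let ?m = "mid m m' 0 n j"
  have "?m 0 = n" "?m 4 = j" using m'0 by (simp_all add: mid_def mem_base_def)
  moreover have "?m (mem_base + out_base + (mem_base + j)) = m (mem_base + out_base + (mem_base + j))"
    using same[of "mem_base + j"] by (simp add: mid_def mem_base_def)
  ultimately show "m' (mem_base + j) = m (mem_base + out_base + (mem_base + j))"
    using f j ev_CopyE[of ?m] by (simp add: filled_def)
qed

end


section \<open>The whole program\<close>

lemma exec_list_append [simp]: "exec_list (a @ b) m = exec_list b (exec_list a m)"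
  by (induction a arbitrary: m) simp_all

text \<open>The matrix occupies the cells that serve as registers. Cell 3, the diagonal entry of vertex 0,
  is known to be 0, so the bits in the cells \<open>4, \<dots>, mem_base - 1\<close> can be packed into it.\<close>

definition prologue :: "instr list" where
  "prologue = concat (map (\<lambda>k. [Add 3 3 3, Add 3 3 (4 + k)]) [0..<mem_base - 4])"

text \<open>The output overwrites the registers as well: register \<open>i\<close> first receives the address of its
  final value, which \<open>Load i i\<close> then fetches without any other register.\<close>

definition epilogue :: "instr list" where
  "epilogue = [Const 0 0, Add 0 0 nvars] @ concat (map (\<lambda>i. [Const i i, Add i i 0]) [1..<mem_base]) @
     map (\<lambda>i. Load i i) [1..<mem_base] @ [Load 0 0]"

lemma straight_prologue: "list_all straight prologue"
  by (auto simp: prologue_def list_all_iff)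

lemma straight_epilogue: "list_all straight epilogue"
  by (auto simp: epilogue_def list_all_iff)

lemma exec_prologue: "m 3 = 0 \<Longrightarrow>
  exec_list prologue m = m(3 := pack (\<lambda>k. m (4 + k)) (mem_base - 4))"
proof -
  assume 0: "m 3 = 0"
  have "exec_list (concat (map (\<lambda>k. [Add 3 3 3, Add 3 3 (4 + k)]) [0..<j])) m =
      m(3 := pack (\<lambda>k. m (4 + k)) j)" for j
    using 0 by (induction j) (auto simp: fun_eq_iff)
  then show ?thesis by (simp add: prologue_def)
qed

lemma exec_address_table:
  "exec_list (concat (map (\<lambda>i. [Const i i, Add i i 0]) [1..<j])) m =
    (\<lambda>v. if 1 \<le> v \<and> v < j then v + m 0 else m v)"
  by (induction j) (auto simp: fun_eq_iff)

text \<open>All pointers lead to \<open>B\<close> or beyond, so no load reads a register that an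
  earlier load has replaced.\<close>

lemma exec_load_table:
  assumes "\<And>v. 1 \<le> v \<Longrightarrow> v < B \<Longrightarrow> B \<le> m v"
  shows "j \<le> B \<Longrightarrow> exec_list (map (\<lambda>i. Load i i) [1..<j]) m =
    (\<lambda>v. if 1 \<le> v \<and> v < j then m (m v) else m v)"
proof (induction j)
  case (Suc j)
  show ?case
  proof (cases "1 \<le> j")
    case True
    then have "B \<le> m j" using assms Suc.prems by simp
    then show ?thesis using Suc True by (auto simp: fun_eq_iff)
  qed (auto simp: fun_eq_iff)
qed (auto simp: fun_eq_iff)

lemma exec_epilogue:
  assumes "m nvars = mem_base + b"
  shows "exec_list epilogue m = (\<lambda>v. if v < mem_base then m (mem_base + b + v) else m v)"
proof -
  define m1 where "m1 = exec_list [Const 0 0, Add 0 0 nvars] m"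
  have m1: "m1 = m(0 := mem_base + b)" using assms by (auto simp: m1_def nvars_def)
  define m2 where "m2 = (\<lambda>v. if 1 \<le> v \<and> v < mem_base then v + m1 0 else m1 v)"
  define m3 where "m3 = exec_list (map (\<lambda>i. Load i i) [1..<mem_base]) m2"
  have m3: "m3 = (\<lambda>v. if 1 \<le> v \<and> v < mem_base then m2 (m2 v) else m2 v)"
    unfolding m3_def by (rule exec_load_table[of mem_base]) (auto simp: m2_def m1)
  \<comment> \<open>Register 0 holds the base of the output, which is just the address of its own
    final value.\<close>
  have "exec_list epilogue m = m3(0 := m3 (m3 0))"
    unfolding epilogue_def exec_list_append m1_def[symmetric] exec_address_table
      m2_def[symmetric] m3_def[symmetric] by simp
  also have "\<dots> = (\<lambda>v. if v < mem_base then m (mem_base + b + v) else m v)"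
    by (auto simp: fun_eq_iff m3 m2_def m1 mem_base_def add_ac)
  finally show ?thesis .
qed

lemma fill_stage:
  assumes t: "fill_time 4 b a e k" and code: "code_at p pc (fill_comp 4 b a e pc)"
    and M: "2 \<le> M" "bnd M m" and wf: "wf_exp e" and a: "\<And>m'. m' 0 = m 0 \<Longrightarrow> ev a m' = base"
    and b: "ev b m = c" "c \<le> M"
    and e: "\<And>i. i < c \<Longrightarrow> bnd M (fill_mem 4 a e m i) \<Longrightarrow> ev e (fill_mem 4 a e m i) \<le> M"
  obtains m' T where "T \<le> M ^ k" "steps p T (pc, m) (pc + fill_len b a e, m')"
    "filled e base c m m'" "bnd M m'"
proof -
  have bG: "bnd M (fill_mem 4 a e m i)" if "i \<le> c" for i
    by (rule fill_mem_bnd[OF M(2) b(2) _ e that]) simp_all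
  obtain m' T where m': "T \<le> M ^ k" "steps p T (pc, m) (pc + fill_len b a e, m')"
    "\<And>v. vis v \<Longrightarrow> m' v = fill_mem 4 a e m c v"
    using t code M b bG unfolding fill_time_def by (metis less_imp_le_nat)
  have "filled e base c m m'" by (rule fill_mem_filled(1)[OF wf a m'(3)])
  moreover have "bnd M m'" using bG[of c] m'(3) by (simp add: bnd_def)
  ultimately show thesis using m'(1,2) that by blast
qed

definition secluded_prog :: "nat \<Rightarrow> instr list" where
  "secluded_prog K = (let
     p1 = length prologue;
     p2 = p1 + fill_len (TabSizeE K) TabBaseE (TabE K);
     p3 = p2 + fill_len (Var 0) (ChainBaseE K) (ChainE K);
     p4 = p3 + fill_len (Plus (Var 0) (Num 1)) (OutBaseE K) (OutE K);
     p5 = p4 + fill_len (Var 0) (Num 0) (CopyE K) in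
   prologue @ fill_comp 4 (TabSizeE K) TabBaseE (TabE K) p1 @
   fill_comp 4 (Var 0) (ChainBaseE K) (ChainE K) p2 @
   fill_comp 4 (Plus (Var 0) (Num 1)) (OutBaseE K) (OutE K) p3 @
   fill_comp 4 (Var 0) (Num 0) (CopyE K) p4 @
   compile (Plus (Num mem_base) (OutBaseE K)) nvars p5 @ epilogue)"

context secluded
begin

lemma output_correct:
  assumes m1: "inp m1" and m2: "inp m2" and m3: "inp m3" and m0: "inp m0"
    and f1: "filled (TabE K) tab_base Q m0 m1"
    and f2: "filled (ChainE K) chain_base n m1 m2"
    and f3: "filled (OutE K) out_base (n + 1) m2 m3"
    and f4: "filled (CopyE K) 0 n m3 m4"
  defines "f \<equiv> \<lambda>v. if v < mem_base then m4 (mem_base + out_base + v) else m4 v"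
  shows "(\<exists>P. is_path n E s t P) \<longrightarrow> optimal_secluded_path n E s t (decode f)"
    and "(\<nexists>P. is_path n E s t P) \<longrightarrow> decode f = []"
proof -
  define T where "T = tab m1"
  define q where "q = goal T"
  have T: "is_table T" and Tle: "\<And>q. q < Q \<Longrightarrow> T q \<le> q + 1"
    unfolding T_def using table_stage[OF m0 f1] by auto
  have q1: "T q \<noteq> 0 \<and> q mod n = s" if "q < Q"
    using least_below_nonzero[of Q "\<lambda>q. of_bool (T q \<noteq> 0 \<and> q mod n = s)"] that
    by (simp add: q_def goal_def split: if_splits)
  have q2: "q \<le> q'" if "q' < Q" "T q' \<noteq> 0" "q' mod n = s" for q'
    unfolding q_def goal_def by (rule least_below_least) (use that in simp_all)
  have chain0: "m2 (mem_base + chain_base) = q"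
    using chain_stage(2)[OF m1 f2] by (simp add: q_def T_def)
  define l where "l = (if q < Q then q div N mod n + 1 else 0)"
  have ln: "l \<le> n" using n_pos by (simp add: l_def Suc_le_eq)
  have f0: "f 0 = l"
    using copy_stage(1)[OF m3 f4, of 0] out_stage(1)[OF m2 f3] chain0
    by (simp add: f_def l_def)
  \<comment> \<open>Cells below \<open>mem_base\<close> come from the epilogue, the others from the
    copy loop.\<close>
  have fS: "f (Suc j) = m2 (mem_base + chain_base + j) mod n" if "j < n" for j
  proof (cases "Suc j < mem_base")
    case True
    then have "f (Suc j) = m4 (mem_base + out_base + Suc j)" by (simp add: f_def)
    then show ?thesis
      using copy_stage(1)[OF m3 f4, of "Suc j"] out_stage(2)[OF m2 f3 that] by simp
  next
    case False
    then obtain i where i: "Suc j = mem_base + i" by (metis le_Suc_ex not_less)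
    then have "i < n" using that by (simp add: mem_base_def)
    then have "f (Suc j) = m3 (mem_base + out_base + Suc j)"
      using copy_stage(2)[OF m3 f4, of i] False i by (simp add: f_def)
    then show ?thesis using out_stage(2)[OF m2 f3 that] by simp
  qed
  \<comment> \<open>Because \<open>T x \<le> x + 1\<close>, following predecessors never increases
    the state, so every read stays inside the table, even past \<open>init\<close>.\<close>
  have chain: "m2 (mem_base + chain_base + j) = ((\<lambda>x. T x - 1) ^^ j) q \<and>
      ((\<lambda>x. T x - 1) ^^ j) q \<le> q" if "q < Q" "j < n" for j
    using that
  proof (induction j)
    case 0
    then show ?case by (simp add: chain0)
  next
    case (Suc j)
    then have IH: "m2 (mem_base + chain_base + j) = ((\<lambda>x. T x - 1) ^^ j) q"
      "((\<lambda>x. T x - 1) ^^ j) q \<le> q" by simp_all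
    then have less: "((\<lambda>x. T x - 1) ^^ j) q < Q" using that(1) by simp
    then have "m2 (mem_base + chain_base + Suc j) = T (((\<lambda>x. T x - 1) ^^ j) q) - 1"
      using chain_stage(3)[OF m1 f2 Suc.prems(2)] IH(1) by (simp add: T_def)
    moreover have "T (((\<lambda>x. T x - 1) ^^ j) q) - 1 \<le> q"
      using Tle[OF less] IH(2) by linarith
    ultimately show ?case by simp
  qed
  have dec: "decode f = map (\<lambda>j. m2 (mem_base + chain_base + j) mod n) [0..<l]"
    unfolding decode_def f0 using fS ln by auto
  show "(\<exists>P. is_path n E s t P) \<longrightarrow> optimal_secluded_path n E s t (decode f)"
  proof
    assume "\<exists>P. is_path n E s t P"
    then obtain P where P: "is_path n E s t P" by blast
    note tp = table_path[OF T P q1 q2]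
    have qQ: "q < Q" by (rule tp(1))
    have decode_eq: "decode f = map (\<lambda>j. ((\<lambda>x. T x - 1) ^^ j) q mod n) [0..<Suc (q div N mod n)]"
    proof -
      have l: "Suc (q div N mod n) = l" using qQ by (simp add: l_def)
      show ?thesis unfolding dec l
      proof (rule map_cong[OF refl])
        fix j assume "j \<in> set [0..<l]"
        then have "j < n" using ln by simp
        from chain[OF qQ this]
        show "m2 (mem_base + chain_base + j) mod n = ((\<lambda>x. T x - 1) ^^ j) q mod n" by simp
      qed
    qed
    show "optimal_secluded_path n E s t (decode f)" unfolding decode_eq by (rule tp(2))
  qed
  show "(\<nexists>P. is_path n E s t P) \<longrightarrow> decode f = []"
  proof
    assume none: "\<nexists>P. is_path n E s t P"
    have "\<not> q < Q" using table_no_path[OF T none, of q] q1 by blast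
    then show "decode f = []" unfolding dec by (simp add: l_def)
  qed
qed

section \<open>Time bound of the whole run\<close>

text \<open>The packed bits \<open>X\<close> stay below \<open>2 ^ mem_base\<close>, and the table
  size \<open>n * (n + 1) * n ^ K\<close> is at most \<open>(n + 1) ^ (K + 2)\<close>.\<close>

definition bound :: nat where "bound = 2 ^ mem_base * (n + 1) ^ (K + 2)"

lemma bound_ge: "2 \<le> bound" "n + 1 \<le> bound" "Q \<le> bound" "X \<le> bound"
proof -
  have 2: "(2::nat) \<le> 2 ^ mem_base" using self_le_power[of 2 mem_base] by (simp add: mem_base_def)
  have pos: "1 \<le> (n + 1) ^ (K + 2)" by (rule one_le_power) simp
  show "2 \<le> bound" using mult_le_mono[OF 2 pos] by (simp add: bound_def)
  have le: "x \<le> bound" if "x \<le> (n + 1) ^ (K + 2)" for x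
    using mult_le_mono[of 1 "2 ^ mem_base", OF _ that] by (simp add: bound_def)
  show "n + 1 \<le> bound" by (rule le) (rule self_le_power, simp_all)
  have "n * (n + 1) * n ^ K \<le> (n + 1) * (n + 1) * (n + 1) ^ K"
    by (intro mult_mono power_mono) simp_all
  then show "Q \<le> bound" by (intro le) (simp only: Q_def N_def power_add power2_eq_square mult_ac)
  have "X < 2 ^ (mem_base - 4)"
    unfolding X_def by (rule pack_less) (rule enc_le, simp)
  also have "(2::nat) ^ (mem_base - 4) \<le> 2 ^ mem_base" by (rule power_increasing) simp_all
  also have "\<dots> \<le> bound" using mult_le_mono[OF order.refl pos, of "2 ^ mem_base"] by (simp add: bound_def)
  finally show "X \<le> bound" by simp
qed

lemma enc_3: "enc 3 = 0"
  using graph n_pos by (auto simp: encode_def simple_graph_def)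

lemma inp_start: "inp (enc(3 := X))"
  by (auto simp: inp_def mem_base_def encode_def)

lemma bnd_start: "bnd bound (enc(3 := X))"
proof -
  have "enc a \<le> n + 1" for a
    using s_less t_less by (auto simp: encode_def)
  then show ?thesis
    using bound_ge by (auto simp: bnd_def intro: order_trans)
qed

text \<open>The shape of \<open>k\<close> is what repeated \<open>add_le_power\<close> produces for
  the seven successive durations.\<close>

lemma run_secluded_prog:
  assumes t1: "fill_time 4 (TabSizeE K) TabBaseE (TabE K) k1"
    and t2: "fill_time 4 (Var 0) (ChainBaseE K) (ChainE K) k2"
    and t3: "fill_time 4 (Plus (Var 0) (Num 1)) (OutBaseE K) (OutE K) k3"
    and t4: "fill_time 4 (Var 0) (Num 0) (CopyE K) k4"
    and t5: "\<And>m M. 2 \<le> M \<Longrightarrow> bnd M m \<Longrightarrow> tm (Plus (Num mem_base) (OutBaseE K)) m \<le> M ^ k5"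
  defines "k \<equiv> Suc (Suc (Suc (Suc (Suc (Suc (length prologue + k1) + k2) + k3) + k4) + k5)
    + length epilogue)"
  shows "\<exists>T f. T \<le> bound ^ k \<and> steps (secluded_prog K) T (0, enc) (length (secluded_prog K), f) \<and>
    ((\<exists>P. is_path n E s t P) \<longrightarrow> optimal_secluded_path n E s t (decode f)) \<and>
    ((\<nexists>P. is_path n E s t P) \<longrightarrow> decode f = [])"
proof -
  define p1 where "p1 = length prologue"
  define p2 where "p2 = p1 + fill_len (TabSizeE K) TabBaseE (TabE K)"
  define p3 where "p3 = p2 + fill_len (Var 0) (ChainBaseE K) (ChainE K)"
  define p4 where "p4 = p3 + fill_len (Plus (Var 0) (Num 1)) (OutBaseE K) (OutE K)"
  define p5 where "p5 = p4 + fill_len (Var 0) (Num 0) (CopyE K)"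
  define e5 where "e5 = Plus (Num mem_base) (OutBaseE K)"
  define p where "p = secluded_prog K"
  have p_eq: "p = prologue @ fill_comp 4 (TabSizeE K) TabBaseE (TabE K) p1 @
   fill_comp 4 (Var 0) (ChainBaseE K) (ChainE K) p2 @
   fill_comp 4 (Plus (Var 0) (Num 1)) (OutBaseE K) (OutE K) p3 @
   fill_comp 4 (Var 0) (Num 0) (CopyE K) p4 @ compile e5 nvars p5 @ epilogue"
    unfolding p_def secluded_prog_def Let_def p1_def p2_def p3_def p4_def p5_def e5_def ..
  have "code_at p 0 (prologue @ fill_comp 4 (TabSizeE K) TabBaseE (TabE K) p1 @
   fill_comp 4 (Var 0) (ChainBaseE K) (ChainE K) p2 @
   fill_comp 4 (Plus (Var 0) (Num 1)) (OutBaseE K) (OutE K) p3 @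
   fill_comp 4 (Var 0) (Num 0) (CopyE K) p4 @ compile e5 nvars p5 @ epilogue)"
    unfolding p_eq[symmetric] by (rule code_at_self)
  then have c: "code_at p 0 prologue" "code_at p p1 (fill_comp 4 (TabSizeE K) TabBaseE (TabE K) p1)"
    "code_at p p2 (fill_comp 4 (Var 0) (ChainBaseE K) (ChainE K) p2)"
    "code_at p p3 (fill_comp 4 (Plus (Var 0) (Num 1)) (OutBaseE K) (OutE K) p3)"
    "code_at p p4 (fill_comp 4 (Var 0) (Num 0) (CopyE K) p4)"
    "code_at p p5 (compile e5 nvars p5)" "code_at p (p5 + len e5) epilogue"
    unfolding code_at_append length_fill_comp length_compile add_0 p1_def[symmetric]
      p2_def[symmetric] p3_def[symmetric] p4_def[symmetric] p5_def[symmetric] by blast+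
  have lenp: "length p = p5 + len e5 + length epilogue"
    unfolding p_eq by (simp add: p1_def p2_def p3_def p4_def p5_def)
  define m0 where "m0 = enc(3 := X)"
  have i0: "inp m0" and b0: "bnd bound m0" unfolding m0_def by (rule inp_start bnd_start)+
  have s0: "steps p (length prologue) (0, enc) (p1, m0)"
    using steps_straight[OF c(1) straight_prologue refl, of enc] exec_prologue[of enc, OF enc_3]
    by (simp add: m0_def X_def p1_def)
  note bg = bound_ge
  \<comment> \<open>The value stored in pass \<open>i\<close> is entry \<open>i\<close> of the
    finished table, for which \<open>table_stage\<close> gives \<open>i + 1\<close>.\<close>
  have e1: "ev (TabE K) (fill_mem 4 TabBaseE (TabE K) m0 i) \<le> bound" if "i < Q" for i
  proof -
    have a: "ev TabBaseE m' = tab_base" if "m' 0 = m0 0" for m'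
      using ev_bases(1)[of m'] that i0 by (simp only: inpD)
    let ?m' = "fill_mem 4 TabBaseE (TabE K) m0 Q"
    have "filled (TabE K) tab_base Q m0 ?m'"
      by (rule fill_mem_filled(1)[OF TabE(1) a refl])
    then have "tab ?m' i \<le> i + 1" by (rule table_stage(2)[OF i0 _ that])
    moreover have "ev (TabE K) (fill_mem 4 TabBaseE (TabE K) m0 i) = tab ?m' i"
      by (rule fill_mem_filled(2)[OF TabE(1) a refl that])
    ultimately show ?thesis using that bg(3) by linarith
  qed
  obtain m1 T1 where m1: "T1 \<le> bound ^ k1" "steps p T1 (p1, m0) (p2, m1)"
    "filled (TabE K) tab_base Q m0 m1" "bnd bound m1"
    unfolding p2_def
    by (rule fill_stage[OF t1 c(2) bg(1) b0 TabE(1), of tab_base Q])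
      (use ev_bases i0 e1 bg in \<open>simp_all add: inpD del: TabBaseE(1) TabSizeE(1)\<close>)
  have i1: "inp m1" by (rule inp_filled[OF i0 m1(3)]) simp
  have inpG: "inp (fill_mem 4 a e m i)"
    if "inp m" "wf_exp e" "\<And>m'. m' 0 = m 0 \<Longrightarrow> ev a m' = base" "tab_base \<le> base" for a e m i base
    by (rule inp_filled[OF that(1) fill_mem_filled(1)[OF that(2,3) refl] that(4)]) assumption
  have a2: "ev (ChainBaseE K) m' = chain_base" if "m' 0 = m1 0" for m'
    using ev_bases(3)[of m'] that i1 by (simp only: inpD)
  have e2: "ev (ChainE K) (fill_mem 4 (ChainBaseE K) (ChainE K) m1 i) \<le> bound"
    if b: "bnd bound (fill_mem 4 (ChainBaseE K) (ChainE K) m1 i)" for i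
  proof -
    let ?G = "fill_mem 4 (ChainBaseE K) (ChainE K) m1 i"
    have "inp ?G" by (rule inpG[OF i1 ChainE(1) a2]) (simp_all add: chain_base_def)
    \<comment> \<open>All \<open>v\<close> are covered, because without a goal the chain starts at
      \<open>Q\<close>, outside the table.\<close>
    moreover have "tab ?G v - 1 \<le> bound" for v
      using b by (auto simp: bnd_def vis_def intro: order_trans[OF diff_le_self])
    moreover have "goal (tab ?G) \<le> bound"
      using least_below_le bg(3) unfolding goal_def by (rule order_trans)
    ultimately show ?thesis by (simp add: ev_ChainE)
  qed
  obtain m2 T2 where m2: "T2 \<le> bound ^ k2" "steps p T2 (p2, m1) (p3, m2)"
    "filled (ChainE K) chain_base n m1 m2" "bnd bound m2"
    unfolding p3_def
    by (rule fill_stage[OF t2 c(3) bg(1) m1(4) ChainE(1), of chain_base n])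
      (use a2 i1 e2 bg in \<open>simp_all add: inpD del: ChainBaseE(1)\<close>)
  have i2: "inp m2" by (rule inp_filled[OF i1 m2(3)]) (simp add: chain_base_def)
  have a3: "ev (OutBaseE K) m' = out_base" if "m' 0 = m2 0" for m'
    using ev_bases(4)[of m'] that i2 by (simp only: inpD)
  have e3: "ev (OutE K) (fill_mem 4 (OutBaseE K) (OutE K) m2 i) \<le> bound" for i
  proof -
    let ?G = "fill_mem 4 (OutBaseE K) (OutE K) m2 i"
    have "inp ?G" by (rule inpG[OF i2 OutE(1) a3]) (simp_all add: chain_base_def out_base_def)
    moreover have "v mod n + 1 \<le> bound" "v mod n \<le> bound" for v
      using mod_less_divisor[OF n_pos, of v] bg(2) by linarith+
    ultimately show ?thesis by (simp add: ev_OutE)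
  qed
  obtain m3 T3 where m3: "T3 \<le> bound ^ k3" "steps p T3 (p3, m2) (p4, m3)"
    "filled (OutE K) out_base (n + 1) m2 m3" "bnd bound m3"
    unfolding p4_def
    by (rule fill_stage[OF t3 c(4) bg(1) m2(4) OutE(1), of out_base "n + 1"])
      (use a3 i2 e3 bg in \<open>simp_all add: inpD del: OutBaseE(1)\<close>)
  have i3: "inp m3" by (rule inp_filled[OF i2 m3(3)]) (simp add: chain_base_def out_base_def)
  have e4: "ev (CopyE K) m \<le> bound" if "bnd bound m" for m
    using that by (simp add: CopyE_def bnd_def vis_def)
  obtain m4 T4 where m4: "T4 \<le> bound ^ k4" "steps p T4 (p4, m3) (p5, m4)"
    "filled (CopyE K) 0 n m3 m4" "bnd bound m4"
    unfolding p5_def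
    by (rule fill_stage[OF t4 c(5) bg(1) m3(4) CopyE(1), of 0 n])
      (use i3 e4 bg in \<open>simp_all add: inpD\<close>)
  have "m4 0 = n" by (rule copy_stage(3)[OF i3 m4(3)])
  then have ev5: "ev e5 m4 = mem_base + out_base"
    using ev_bases(4)[of m4] by (simp add: e5_def del: OutBaseE(1))
  have "wf_exp e5" "fits e5 nvars" by (simp_all add: e5_def nvars_def)
  from compile_correct[OF this(1) order.refl this(2) c(6), of m4] obtain m5 where m5:
    "steps p (tm e5 m4) (p5, m4) (p5 + len e5, m5)" "m5 nvars = mem_base + out_base"
    "\<And>v. v < nvars \<or> mem_base \<le> v \<Longrightarrow> m5 v = m4 v" unfolding ev5 by blast
  define f where "f = (\<lambda>v. if v < mem_base then m4 (mem_base + out_base + v) else m4 v)"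
  have "exec_list epilogue m5 = f"
    unfolding exec_epilogue[of m5 out_base, OF m5(2)] f_def using m5(3) by (auto simp: fun_eq_iff simp del: var_less)
  then have s6: "steps p (length epilogue) (p5 + len e5, m5) (length p, f)"
    using steps_straight[OF c(7) straight_epilogue refl, of m5] lenp by simp
  have t5': "tm e5 m4 \<le> bound ^ k5" unfolding e5_def by (rule t5[OF bg(1) m4(4)])
  let ?T = "length prologue + T1 + T2 + T3 + T4 + tm e5 m4 + length epilogue"
  have S: "steps p ?T (0, enc) (length p, f)"
    by (rule steps_trans[OF steps_trans[OF steps_trans[OF steps_trans[OF steps_trans[OF
        steps_trans[OF s0 m1(2)] m2(2)] m3(2)] m4(2)] m5(1)] s6])
  have le: "?T \<le> bound ^ k"
    unfolding k_def
    by (intro add_le_power bg(1) m1(1) m2(1) m3(1) m4(1) t5' le_power_self)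
  note correct = output_correct[OF i1 i2 i3 i0 m1(3) m2(3) m3(3) m4(3), folded f_def]
  show ?thesis
    by (rule exI[of _ ?T], rule exI[of _ f]) (intro conjI le S[unfolded p_def] correct)
qed

end

theorem theorem4:
  shows "\<forall>\<Delta>::nat. \<exists>p. solves_secluded_path_poly \<Delta> p"
proof
  fix \<Delta> :: nat
  \<comment> \<open>The value of \<open>K\<close>, named outside the locale so that program and
    exponents depend on \<open>\<Delta>\<close> only.\<close>
  define D where "D = \<Delta> + 3"
  obtain k1 where t1: "fill_time 4 (TabSizeE D) TabBaseE (TabE D) k1"
    by (rule fill_poly[of "TabSizeE D" TabBaseE "TabE D" 4]) (simp_all add: nvars_def)
  obtain k2 where t2: "fill_time 4 (Var 0) (ChainBaseE D) (ChainE D) k2"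
    by (rule fill_poly[of "Var 0" "ChainBaseE D" "ChainE D" 4]) (simp_all add: nvars_def)
  obtain k3 where t3: "fill_time 4 (Plus (Var 0) (Num 1)) (OutBaseE D) (OutE D) k3"
    by (rule fill_poly[of "Plus (Var 0) (Num 1)" "OutBaseE D" "OutE D" 4])
      (simp_all add: nvars_def)
  obtain k4 where t4: "fill_time 4 (Var 0) (Num 0) (CopyE D) k4"
    by (rule fill_poly[of "Var 0" "Num 0" "CopyE D" 4]) (simp_all add: nvars_def)
  obtain k5 where t5: "\<And>m M. 2 \<le> M \<Longrightarrow> bnd M m \<Longrightarrow> tm (Plus (Num mem_base) (OutBaseE D)) m \<le> M ^ k5"
    using tm_poly[of "Plus (Num mem_base) (OutBaseE D)"] by (metis OutBaseE(2) wf_exp.simps(1,4))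
  define k where "k = Suc (Suc (Suc (Suc (Suc (Suc (length prologue + k1) + k2) + k3) + k4) + k5)
    + length epilogue)"
  have "let cf = run (secluded_prog D) ((2 ^ mem_base) ^ k * (n + 1) ^ ((D + 2) * k)) (encode n E s t) in
      halted (secluded_prog D) cf \<and>
      ((\<exists>P. is_path n E s t P) \<longrightarrow> optimal_secluded_path n E s t (decode (snd cf))) \<and>
      ((\<nexists>P. is_path n E s t P) \<longrightarrow> decode (snd cf) = [])"
    if "simple_graph n E" "max_degree_le n E \<Delta>" "s < n" "t < n" for n E s t
  proof -
    interpret secluded n E s t \<Delta> by unfold_locales (fact that)+
    have KD: "K = D" by (simp add: K_def D_def)
    obtain T f where T: "T \<le> bound ^ k"
      "steps (secluded_prog D) T (0, encode n E s t) (length (secluded_prog D), f)"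
      "(\<exists>P. is_path n E s t P) \<longrightarrow> optimal_secluded_path n E s t (decode f)"
      "(\<nexists>P. is_path n E s t P) \<longrightarrow> decode f = []"
      using run_secluded_prog[unfolded KD, OF t1 t2 t3 t4 t5] unfolding k_def by blast
    have "bound ^ k = (2 ^ mem_base) ^ k * (n + 1) ^ ((D + 2) * k)"
      unfolding bound_def KD power_mult_distrib power_mult ..
    with T(1) obtain U where U: "(2 ^ mem_base) ^ k * (n + 1) ^ ((D + 2) * k) = U + T"
      by (metis le_Suc_ex add.commute)
    have "halted (secluded_prog D) (length (secluded_prog D), f)" by (simp add: halted_def)
    \<comment> \<open>A halted machine stays put, so the surplus \<open>U\<close> of the time budget
      does no harm.\<close>
    then have "run (secluded_prog D) (U + T) (encode n E s t) = (length (secluded_prog D), f)"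
      using T(2) halted_funpow unfolding run_def steps_def by (simp add: funpow_add)
    with T(3,4) show ?thesis unfolding U by (simp add: halted_def)
  qed
  then have "solves_secluded_path_poly \<Delta> (secluded_prog D)"
    unfolding solves_secluded_path_poly_def by blast
  then show "\<exists>p. solves_secluded_path_poly \<Delta> p" by blast
qed


end
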